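(* Let $r,\ell,k$ be integers with $r\ge 3$, $1\le \ell\le r$ and $k\ge 1+r-\ell$. If it is not the case that both $\ell=1$ and $k\ge 2r$, then $$\mathrm{cov}(r,\ell,k)=1+\Bigl\lfloor \frac{k-r+\ell-1}{\ell}\Bigr\rfloor .$$ If $\ell=1$ and $k\ge 2r$, then $$1+\Bigl\lfloor \frac{k-r+\ell-1}{\ell}\Bigr\rfloor\le \mathrm{cov}(r,\ell,k)\le 2+\Bigl\lfloor \frac{k-r+\ell-1}{\ell}\Bigr\rfloor .$$
   Context: For $1\le\ell\le r$, a hypergraph is complete $r$-uniform $(r,\ell)$-partite if its vertex set $V$ is partitioned into $r$ nonempty classes $V_1\cup\dots\cup V_r$ and its edge set consists of all $r$-element subsets of $V$ that intersect each class in at most $\ell$ vertices. A $k$-coloring of a hypergraph is an assignment of a color from $[k]=\{1,\dots,k\}$ to each edge (not all $k$ colors need be used). A coloring is spanning if every vertex is incident to edges of every color used in the coloring. For an edge-colored hypergraph $H$, let $H_i$ be the subhypergraph on vertex set $V(H)$ consisting of the edges of color $i$. A hypergraph is connected if it has only one vertex or any two distinct vertices can be connected by a sequence of edges each intersecting the next; every hypergraph is uniquely partitioned into connected components. A monochromatic component of $H$ is (the vertex set of) a connected component of $H_i$ for some color $i$. $\mathrm{cov}(r,\ell,k)$ is the minimum integer $m$ such that for every complete $r$-uniform $(r,\ell)$-partite hypergraph and every spanning $k$-coloring of its edges, the vertex set can be covered by at most $m$ monochromatic components. *)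

theory Defs
  imports Complex_Main "HOL-Library.Disjoint_Sets" "HOL-Library.FuncSet"
begin

text \<open>A hypergraph is given by its vertex set \<open>V\<close> and its set \<open>E\<close> of edges.
  As usual in this subject, hypergraphs are finite. The \<open>r\<close> classes form the set \<open>P\<close>;
  \<^const>\<open>partition_on\<close> requires them to be nonempty and pairwise disjoint with union \<open>V\<close>.\<close>

definition complete_partite :: "nat \<Rightarrow> nat \<Rightarrow> 'v set \<Rightarrow> 'v set set \<Rightarrow> bool" where
  "complete_partite r l V E \<longleftrightarrow> finite V \<and>
     (\<exists>P. partition_on V P \<and> card P = r \<and>
          E = {e. e \<subseteq> V \<and> card e = r \<and> (\<forall>X\<in>P. card (e \<inter> X) \<le> l)})"

definition edge_coloring :: "nat \<Rightarrow> 'v set set \<Rightarrow> ('v set \<Rightarrow> nat) \<Rightarrow> bool" where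
  "edge_coloring k E c \<longleftrightarrow> c \<in> E \<rightarrow> {1..k}"

definition spanning_coloring :: "'v set \<Rightarrow> 'v set set \<Rightarrow> ('v set \<Rightarrow> nat) \<Rightarrow> bool" where
  "spanning_coloring V E c \<longleftrightarrow> (\<forall>v\<in>V. \<forall>i\<in>c ` E. \<exists>e\<in>E. v \<in> e \<and> c e = i)"

definition color_edges :: "'v set set \<Rightarrow> ('v set \<Rightarrow> nat) \<Rightarrow> nat \<Rightarrow> 'v set set" where
  "color_edges E c i = {e \<in> E. c e = i}"

definition edge_linked :: "'v set set \<Rightarrow> 'v \<Rightarrow> 'v \<Rightarrow> bool" where
  "edge_linked E u v \<longleftrightarrow>
     (\<exists>es. es \<noteq> [] \<and> set es \<subseteq> E \<and> u \<in> hd es \<and> v \<in> last es \<and>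
           successively (\<lambda>e f. e \<inter> f \<noteq> {}) es)"

definition hypergraph_connected :: "'v set \<Rightarrow> 'v set set \<Rightarrow> bool" where
  "hypergraph_connected V E \<longleftrightarrow>
     card V = 1 \<or> (\<forall>u\<in>V. \<forall>v\<in>V. u \<noteq> v \<longrightarrow> edge_linked E u v)"

definition connected_on :: "'v set set \<Rightarrow> 'v set \<Rightarrow> bool" where
  "connected_on E C \<longleftrightarrow> C \<noteq> {} \<and> hypergraph_connected C {e \<in> E. e \<subseteq> C}"

text \<open>The connected components, as vertex sets: the maximal nonempty sets of vertices that
  induce a connected subhypergraph. A vertex in no edge is a component by itself.\<close>

definition hypergraph_components :: "'v set \<Rightarrow> 'v set set \<Rightarrow> 'v set set" where
  "hypergraph_components V E =
     {C. C \<subseteq> V \<and> connected_on E C \<and>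
         (\<forall>D. C \<subseteq> D \<and> D \<subseteq> V \<and> connected_on E D \<longrightarrow> D = C)}"

definition mono_components ::
    "nat \<Rightarrow> 'v set \<Rightarrow> 'v set set \<Rightarrow> ('v set \<Rightarrow> nat) \<Rightarrow> 'v set set" where
  "mono_components k V E c = (\<Union>i\<in>{1..k}. hypergraph_components V (color_edges E c i))"

definition mono_coverable ::
    "nat \<Rightarrow> 'v set \<Rightarrow> 'v set set \<Rightarrow> ('v set \<Rightarrow> nat) \<Rightarrow> nat \<Rightarrow> bool" where
  "mono_coverable k V E c m \<longleftrightarrow>
     (\<exists>\<C>. \<C> \<subseteq> mono_components k V E c \<and> finite \<C> \<and> card \<C> \<le> m \<and> V \<subseteq> \<Union>\<C>)"

text \<open>Every finite hypergraph is isomorphic to one whose vertices are natural numbers, so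
  it suffices to let the vertex set range over sets of natural numbers.\<close>

definition cov :: "nat \<Rightarrow> nat \<Rightarrow> nat \<Rightarrow> nat" where
  "cov r l k =
     (LEAST m. \<forall>(V :: nat set) E c.
        complete_partite r l V E \<longrightarrow> edge_coloring k E c \<longrightarrow> spanning_coloring V E c \<longrightarrow>
        mono_coverable k V E c m)"

end

theory Submission imports Defs begin

text \<open>Describe a vertex by the vector of its monochromatic components and let \<open>agr S\<close> be the set
  of colours in which \<open>S\<close> lies in a single component; an edge agrees in at least one colour. If no
  single component covers \<open>V\<close>, then extending a partial edge \<open>S\<close> greedily, each new vertex
  destroying one colour, shows \<open>|agr S| + |S| > r\<close>.

  For \<open>l \<ge> 2\<close>, if no \<open>q + 1\<close> components cover \<open>V\<close>, some pair of vertices disagrees in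
  \<open>2(q + 1)\<close> colours, and each of \<open>l - 2\<close> further vertices can be chosen to destroy \<open>q + 1\<close> more
  colours, which contradicts the inequality for \<open>|S| = l\<close>.

  For \<open>l = 1\<close>, delete colours as long as every edge still agrees somewhere. Then some edge \<open>e\<close>
  agrees in exactly one colour. By the inequality every vertex of \<open>e\<close> is, in some colour, the only
  one outside the component of the others, and suitable majority components of \<open>e\<close> cover \<open>V\<close>.
  For \<open>r = 3\<close> this is supplemented by components through further vertices.

  The lower bound comes from vectors whose entries mostly name one large component per colour.\<close>

section \<open>Systems of component vectors\<close>

text \<open>The obstacle is that nothing controls the class of a vertex left uncovered by a family
  of components. For \<open>l\<close> at least 2 this is harmless, because any \<open>l\<close>
  vertices form a partial edge. The count then closes exactly: \<open>l\<close> vertices that remove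
  \<open>q + 1\<close> colours each from at most \<open>r + q * l\<close> leave at most
  \<open>r - l\<close>, one fewer than the inequality demands. For \<open>l = 1\<close> a vertex can
  be added to a partial edge only if its class is still free, so covers are built around one fixed
  edge. Deleting colours makes this edge rigid: it agrees in a single colour \<open>j\<close>, and
  its vertices own disjoint nonempty sets of private colours. The sharp bound asks for a saving of
  \<open>r - 1\<close> components out of one per colour. One edge provides this if
  \<open>4 \<le> r\<close>. For \<open>r = 3\<close> the saving is recovered for at most five
  colours, and with more colours one component is given away.

  In the lower bound an edge leaves the large components in at most \<open>q * l + (r - l)\<close>
  colours, and this being smaller than \<open>k\<close> is exactly the condition on
  \<open>q\<close>.\<close>

text \<open>\<open>p i v\<close> names the component of colour \<open>i\<close> containing \<open>v\<close>, and \<open>K\<close> is the set of colours that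
  are used; \<open>span\<close> is what remains of the colouring being spanning.\<close>

locale partite_system =
  fixes r l :: nat and V :: "'v set" and cl :: "'v \<Rightarrow> 'b" and K :: "nat set"
    and p :: "nat \<Rightarrow> 'v \<Rightarrow> 'c"
  assumes finite_V: "finite V" and finite_K: "finite K" and K_nonempty: "K \<noteq> {}"
    and card_classes: "card (cl ` V) = r"
    and l_pos: "1 \<le> l" and l_le_r: "l \<le> r"
    and edge: "\<And>e. e \<subseteq> V \<Longrightarrow> card e = r \<Longrightarrow> (\<And>c. card {v \<in> e. cl v = c} \<le> l)
                 \<Longrightarrow> \<exists>i\<in>K. \<forall>u\<in>e. \<forall>v\<in>e. p i u = p i v"
    and span: "\<And>v i. v \<in> V \<Longrightarrow> i \<in> K \<Longrightarrow> \<exists>e\<subseteq>V. card e = r \<and> v \<in> e \<and>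
                 (\<forall>c. card {v \<in> e. cl v = c} \<le> l) \<and> (\<forall>w\<in>e. p i w = p i v)"
begin

definition part :: "'v set \<Rightarrow> bool" where
  "part S \<longleftrightarrow> S \<subseteq> V \<and> (\<forall>c. card {v \<in> S. cl v = c} \<le> l)"

definition agr :: "'v set \<Rightarrow> nat set" where
  "agr S = {i \<in> K. \<forall>u\<in>S. \<forall>v\<in>S. p i u = p i v}"

text \<open>A component is encoded by a colour and one of its vertices, so covers never refer to the
  values of \<open>p\<close> by name.\<close>

definition coverable :: "nat \<Rightarrow> bool" where
  "coverable m \<longleftrightarrow>
     (\<exists>T \<subseteq> K \<times> V. card T \<le> m \<and> (\<forall>w\<in>V. \<exists>(i, u)\<in>T. p i w = p i u))"

lemma finite_agr [simp]: "finite (agr S)" and agr_sub: "agr S \<subseteq> K"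
  using finite_K unfolding agr_def by auto

lemma agr_antimono: "S \<subseteq> S' \<Longrightarrow> agr S' \<subseteq> agr S"
  unfolding agr_def by blast

lemma agrD: "i \<in> agr S \<Longrightarrow> u \<in> S \<Longrightarrow> v \<in> S \<Longrightarrow> p i u = p i v"
  unfolding agr_def by blast

lemma agr_insert: "u \<in> S \<Longrightarrow> agr (insert w S) = {i \<in> agr S. p i w = p i u}"
  unfolding agr_def by (rule set_eqI, unfold ball_simps mem_Collect_eq) metis

lemma agr_single [simp]: "agr {u} = K"
  by (simp add: agr_def)

lemma agr_pair: "agr {u, v} = {i \<in> K. p i u = p i v}"
  using agr_insert[of v "{v}" u] by simp

lemma part_finite: "part S \<Longrightarrow> finite S"
  using finite_V finite_subset by (auto simp: part_def)

lemma part_subV: "part S \<Longrightarrow> S \<subseteq> V"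
  by (simp add: part_def)

lemma part_subset: assumes "part S" "S' \<subseteq> S" shows "part S'"
proof -
  have "card {v \<in> S'. cl v = c} \<le> card {v \<in> S. cl v = c}" for c
    using assms part_finite[OF assms(1)] by (intro card_mono) auto
  then show ?thesis
    using assms le_trans unfolding part_def by blast
qed

lemma part_small: "S \<subseteq> V \<Longrightarrow> card S \<le> l \<Longrightarrow> part S"
  unfolding part_def
  by (auto intro: order_trans[OF card_mono] finite_subset[OF _ finite_V])

lemma coverable_mono: "coverable m \<Longrightarrow> m \<le> n \<Longrightarrow> coverable n"
  unfolding coverable_def by (meson le_trans)

lemma uncovered:
  assumes "\<not> coverable m" "T \<subseteq> K \<times> V" "card T \<le> m"
  obtains w where "w \<in> V" "\<And>i u. (i, u) \<in> T \<Longrightarrow> p i w \<noteq> p i u"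
proof -
  have "\<not> (\<forall>w\<in>V. \<exists>(i, u)\<in>T. p i w = p i u)"
    using assms unfolding coverable_def by blast
  then obtain w where "w \<in> V" "\<forall>(i, u)\<in>T. p i w \<noteq> p i u" by auto
  then show thesis by (intro that[of w]) auto
qed

lemma uncovered_map:
  assumes "\<not> coverable m" "I \<subseteq> K" "card I \<le> m" "\<And>i. i \<in> I \<Longrightarrow> f i \<in> V"
  obtains w where "w \<in> V" "\<And>i. i \<in> I \<Longrightarrow> p i w \<noteq> p i (f i)"
proof -
  have fin: "finite I" using assms(2) finite_K finite_subset by blast
  have "card ((\<lambda>i. (i, f i)) ` I) \<le> m"
    using card_image_le[OF fin] assms(3) le_trans by blast
  moreover have "(\<lambda>i. (i, f i)) ` I \<subseteq> K \<times> V" using assms(2,4) by auto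
  ultimately obtain w where "w \<in> V" "\<And>i u. (i, u) \<in> (\<lambda>i. (i, f i)) ` I \<Longrightarrow> p i w \<noteq> p i u"
    using uncovered[OF assms(1)] by blast
  then show thesis by (intro that[of w]) auto
qed

lemma uncovered_at:
  assumes "\<not> coverable m" "I \<subseteq> K" "card I \<le> m" "u \<in> V"
  obtains w where "w \<in> V" "\<And>i. i \<in> I \<Longrightarrow> p i w \<noteq> p i u"
  by (rule uncovered_map[OF assms(1-3), where f = "\<lambda>_. u"]) (use assms(4) that in auto)

text \<open>Partial edges are the independent sets of a partition matroid with capacity
  \<open>l\<close> on every class. If no vertex of \<open>e\<close> could be added, each class would
  be full in \<open>S\<close> or have all its vertices of \<open>e\<close> in \<open>S\<close>, and
  summing over classes gives \<open>card e \<le> card S\<close>.\<close>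

lemma part_exchange:
  assumes S: "part S" and e: "part e" and less: "card S < card e"
  obtains w where "w \<in> e - S" "part (insert w S)"
proof (rule ccontr)
  assume neg: "\<not> thesis"
  have fS: "finite S" and fe: "finite e" using S e part_finite by auto
  let ?C = "cl ` (S \<union> e)"
  have split: "card A = (\<Sum>c\<in>?C. card {v \<in> A. cl v = c})" if "A \<subseteq> S \<union> e" for A
  proof -
    have "card A = card (\<Union>c\<in>?C. {v \<in> A. cl v = c})"
      using that by (intro arg_cong[where f = card]) auto
    also have "\<dots> = (\<Sum>c\<in>?C. card {v \<in> A. cl v = c})"
      using fS fe finite_subset[OF that] by (intro card_UN_disjoint) auto
    finally show ?thesis .
  qed
  have "card {v \<in> e. cl v = c} \<le> card {v \<in> S. cl v = c}" for c
  proof (cases "{v \<in> e. cl v = c} \<subseteq> S")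
    case True
    then show ?thesis using fS by (intro card_mono) auto
  next
    case False
    then obtain w where w: "w \<in> e" "cl w = c" "w \<notin> S" by auto
    then have "\<not> part (insert w S)" using neg that by auto
    moreover have "insert w S \<subseteq> V" using S e w by (auto simp: part_def)
    ultimately obtain c' where c': "l < card {v \<in> insert w S. cl v = c'}"
      unfolding part_def by (auto simp: not_le)
    have "c' = c"
    proof (rule ccontr)
      assume "c' \<noteq> c"
      then have "{v \<in> insert w S. cl v = c'} = {v \<in> S. cl v = c'}" using w by auto
      then show False using c' S by (auto simp: part_def not_le dest: leD)
    qed
    moreover have "{v \<in> insert w S. cl v = c} = insert w {v \<in> S. cl v = c}" using w by auto
    ultimately have "l \<le> card {v \<in> S. cl v = c}" using c' w fS by auto
    moreover have "card {v \<in> e. cl v = c} \<le> l" using e by (auto simp: part_def)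
    ultimately show ?thesis by simp
  qed
  then have "card e \<le> card S" using split[of e] split[of S] by (simp add: sum_mono)
  then show False using less by simp
qed

lemma agr_edge:
  assumes "part e" "card e = r"
  shows "agr e \<noteq> {}"
proof -
  have "\<exists>i. i \<in> K \<and> (\<forall>u\<in>e. \<forall>v\<in>e. p i u = p i v)"
    unfolding Bex_def[symmetric] by (rule edge) (use assms in \<open>auto simp: part_def\<close>)
  then show ?thesis unfolding agr_def Collect_empty_eq by blast
qed

text \<open>A colour \<open>i\<close> of \<open>agr S\<close> has a vertex outside the component of
  \<open>S\<close>, and spanning puts an edge of size \<open>r\<close> entirely into the component
  of that vertex. Exchange moves a vertex of this edge into \<open>S\<close>, which removes
  \<open>i\<close>; so the sum on the right does not increase while \<open>S\<close> grows to a full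
  edge, where one colour must survive.\<close>

lemma card_agr:
  assumes unc: "\<not> coverable 1" and "part S" "S \<noteq> {}" "card S \<le> r"
  shows "r < card (agr S) + card S"
  using assms(2-)
proof (induction "r - card S" arbitrary: S)
  case 0
  then have "card S = r" by simp
  then have "agr S \<noteq> {}" using agr_edge 0(2) by blast
  then have "0 < card (agr S)" by (auto simp: card_gt_0_iff)
  then show ?case using \<open>card S = r\<close> by simp
next
  case (Suc n)
  obtain u where u: "u \<in> S" "u \<in> V" using Suc.prems by (auto simp: part_def)
  obtain e where e: "part e" "card e = r" and
    hit: "agr S \<noteq> {} \<Longrightarrow> \<exists>i\<in>agr S. \<forall>w\<in>e. p i w \<noteq> p i u"
  proof (cases "agr S = {}")
    case True
    obtain i where "i \<in> K" using K_nonempty by auto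
    then show thesis using span[OF u(2)] that True unfolding part_def by metis
  next
    case False
    then obtain i where i: "i \<in> agr S" by auto
    then obtain w where "w \<in> V" "p i w \<noteq> p i u"
      using uncovered_at[OF unc, of "{i}" u] u(2) agr_sub by auto
    moreover obtain e where "e \<subseteq> V" "card e = r" "\<forall>c. card {v \<in> e. cl v = c} \<le> l"
      "\<forall>v\<in>e. p i v = p i w"
      using span[OF \<open>w \<in> V\<close>] i agr_sub by (meson subsetD)
    ultimately show thesis using that[of e] i unfolding part_def by metis
  qed
  have lt: "card S < r" using Suc.hyps(2) by simp
  then obtain w where w: "w \<in> e - S" "part (insert w S)"
    using part_exchange[OF Suc.prems(1) e(1)] e(2) by metis
  have card: "card (insert w S) = Suc (card S)"
    using w part_finite[OF Suc.prems(1)] by auto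
  have IH: "r < card (agr (insert w S)) + card (insert w S)"
    using Suc.hyps w card lt by (intro Suc.hyps(1)) auto
  show ?case
  proof (cases "agr S = {}")
    case True
    then have "agr (insert w S) = {}" using agr_antimono[of S "insert w S"] by auto
    then show ?thesis using IH card lt by simp
  next
    case False
    then obtain i where "i \<in> agr S" "p i w \<noteq> p i u" using hit w by auto
    then have "agr (insert w S) \<subset> agr S" using agr_insert[OF u(1)] by auto
    then have "card (agr (insert w S)) < card (agr S)" by (simp add: psubset_card_mono)
    then show ?thesis using IH card by simp
  qed
qed

text \<open>If \<open>w\<close> missed all of \<open>I\<close>, the set \<open>insert w S\<close>
  would agree only in \<open>agr S - I\<close>, which is too small for \<open>card_agr\<close>. In
  applications \<open>I\<close> consists of the colours kept in a cover, and the bound says how many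
  may be dropped.\<close>

lemma agr_hits:
  assumes unc: "\<not> coverable 1" and S: "part (insert w S)" "w \<notin> S" "u \<in> S"
    and I: "I \<subseteq> agr S" "card (agr S - I) + card S < r"
  shows "\<exists>i\<in>I. p i w = p i u"
proof (rule ccontr)
  assume "\<not> ?thesis"
  then have "agr (insert w S) \<subseteq> agr S - I" using agr_insert[OF S(3)] by auto
  then have "card (agr (insert w S)) \<le> card (agr S - I)" by (intro card_mono) auto
  moreover have "card (insert w S) = Suc (card S)"
    using S part_finite[OF S(1)] by auto
  ultimately show False
    using card_agr[OF unc S(1)] I(2) by auto
qed

subsection \<open>The case of at least two vertices per class\<close>

text \<open>In a colour of \<open>I\<close> the vertex \<open>w\<close> differs from both
  \<open>u\<close> and \<open>v\<close>. So the union of the two agreement sets lies in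
  \<open>K - I\<close> and their intersection in \<open>agr {u, v} - I\<close>; adding the two sizes
  counts \<open>I\<close> twice.\<close>

lemma agr_far:
  assumes "u \<in> V" "v \<in> V" "w \<in> V" "I \<subseteq> agr {u, v}" "\<And>i. i \<in> I \<Longrightarrow> p i w \<noteq> p i u"
  shows "card (agr {w, u}) + card (agr {w, v}) + 2 * card I \<le> card K + card (agr {u, v})"
proof -
  have fin: "finite I" using finite_subset[OF assms(4) finite_agr] .
  have IK: "I \<subseteq> K" using assms(4) agr_sub by blast
  have ne: "p i w \<noteq> p i u" "p i w \<noteq> p i v" if "i \<in> I" for i
  proof -
    have "p i u = p i v" using agrD[of i "{u, v}" u v] assms(4) that by blast
    then show "p i w \<noteq> p i u" "p i w \<noteq> p i v" using assms(5)[OF that] by auto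
  qed
  have "agr {w, u} \<union> agr {w, v} \<subseteq> K - I"
    using ne by (auto simp: agr_pair)
  then have "card (agr {w, u} \<union> agr {w, v}) \<le> card K - card I"
    using card_mono[of "K - I"] finite_K card_Diff_subset[OF fin IK] by auto
  moreover have "agr {w, u} \<inter> agr {w, v} \<subseteq> agr {u, v} - I"
    using ne by (auto simp: agr_pair)
  then have "card (agr {w, u} \<inter> agr {w, v}) \<le> card (agr {u, v}) - card I"
    using card_mono[of "agr {u, v} - I"] card_Diff_subset[OF fin assms(4)] by auto
  moreover have "card I \<le> card (agr {u, v})" "card I \<le> card K"
    using assms(4) IK finite_K by (auto intro: card_mono)
  moreover have "card (agr {w, u}) + card (agr {w, v})
      = card (agr {w, u} \<union> agr {w, v}) + card (agr {w, u} \<inter> agr {w, v})"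
    by (intro card_Un_Int) auto
  ultimately show ?thesis by linarith
qed

text \<open>Among pairs from different classes one with least agreement is taken. A vertex
  \<open>w\<close> far from it differs in class from \<open>u\<close> or from \<open>v\<close>; that
  pair agrees at least as often as the minimum, so \<open>agr_far\<close> leaves little for the
  other pair, which may lie in one class.\<close>

lemma far_pair:
  assumes "3 \<le> r" "2 \<le> l" and unc: "\<not> coverable (Suc q)"
  obtains u v where "u \<in> V" "v \<in> V" "card (agr {u, v}) + 2 * Suc q \<le> card K"
proof -
  have unc1: "\<not> coverable 1" using unc coverable_mono by fastforce
  let ?X = "{(u, v). u \<in> V \<and> v \<in> V \<and> cl u \<noteq> cl v}"
  have "\<exists>u\<in>V. \<exists>v\<in>V. cl u \<noteq> cl v"
  proof (rule ccontr)
    assume "\<not> ?thesis"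
    then have eq: "cl u = cl v" if "u \<in> V" "v \<in> V" for u v using that by blast
    have "V \<noteq> {}" using card_classes assms(1) by auto
    then obtain u0 where "u0 \<in> V" by blast
    then have "cl ` V \<subseteq> {cl u0}" using eq[of _ u0] by blast
    then have "card (cl ` V) \<le> card {cl u0}" by (intro card_mono) auto
    then show False using card_classes assms(1) by simp
  qed
  then have "?X \<noteq> {}" by auto
  then obtain x where x: "x \<in> ?X" and min: "\<And>y. y \<in> ?X \<Longrightarrow> card (agr {fst x, snd x}) \<le> card (agr {fst y, snd y})"
    by (metis (no_types, lifting) ex_has_least_nat[of "\<lambda>y. y \<in> ?X" _ "\<lambda>y. card (agr {fst y, snd y})"] ex_in_conv)
  define u v where "u = fst x" and "v = snd x"
  have uv: "u \<in> V" "v \<in> V" "cl u \<noteq> cl v" using x by (auto simp: u_def v_def)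
  have min': "card (agr {u, v}) \<le> card (agr {u', v'})" if "u' \<in> V" "v' \<in> V" "cl u' \<noteq> cl v'" for u' v'
    using min[of "(u', v')"] that by (auto simp: u_def v_def)
  \<comment> \<open>Otherwise some \<open>w\<close> avoids every colour of
    \<open>agr {u, v}\<close>. As \<open>u\<close> and \<open>v\<close> lie in different classes and
    \<open>2 \<le> l\<close>, the set \<open>{w, u, v}\<close> is a partial edge, and it would agree
    nowhere.\<close>
  have "Suc q \<le> card (agr {u, v})"
  proof (rule ccontr)
    assume "\<not> ?thesis"
    then obtain w where w: "w \<in> V" "\<And>i. i \<in> agr {u, v} \<Longrightarrow> p i w \<noteq> p i u"
      using uncovered_at[OF unc agr_sub _ uv(1), of "{u, v}"] by auto
    have two: "{x \<in> {w, u, v}. cl x = c} \<subseteq> {w, u} \<or> {x \<in> {w, u, v}. cl x = c} \<subseteq> {w, v}" for c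
      using uv(3) by auto
    have "card {x \<in> {w, u, v}. cl x = c} \<le> 2" for c
    proof -
      have "card {x \<in> {w, u, v}. cl x = c} \<le> max (card {w, u}) (card {w, v})"
        using two[of c] by (elim disjE) (auto intro!: card_mono simp: le_max_iff_disj)
      also have "\<dots> \<le> 2" by (simp add: card_insert_if)
      finally show ?thesis .
    qed
    then have "\<forall>c. card {x \<in> {w, u, v}. cl x = c} \<le> l" using assms(2) order_trans by blast
    then have "part {w, u, v}" using uv w(1) by (simp add: part_def)
    moreover have "agr {w, u, v} = {}" using w agr_insert[of u "{u, v}" w] by auto
    moreover have "card {w, u, v} \<le> 3"
      by (simp add: card_insert_if)
    ultimately show False using card_agr[OF unc1, of "{w, u, v}"] assms(1) by auto
  qed
  then obtain I where I: "I \<subseteq> agr {u, v}" "card I = Suc q"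
    by (metis obtain_subset_with_card_n)
  have "I \<subseteq> K" using I agr_sub by blast
  then obtain w where w: "w \<in> V" "\<And>i. i \<in> I \<Longrightarrow> p i w \<noteq> p i u"
    using uncovered_at[OF unc _ _ uv(1), of I] I(2) by auto
  have far: "card (agr {w, u}) + card (agr {w, v}) + 2 * Suc q \<le> card K + card (agr {u, v})"
    using agr_far[OF uv(1,2) w(1) I(1)] w(2) I(2) by auto
  show thesis
  proof (cases "cl w = cl v")
    case True
    then have "card (agr {u, v}) \<le> card (agr {w, u})" using min'[OF w(1) uv(1)] uv(3) by simp
    then have "card (agr {w, v}) + 2 * Suc q \<le> card K" using far by linarith
    then show thesis by (rule that[OF w(1) uv(2)])
  next
    case False
    then have "card (agr {u, v}) \<le> card (agr {w, v})" using min'[OF w(1) uv(2)] by simp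
    then have "card (agr {w, u}) + 2 * Suc q \<le> card K" using far by linarith
    then show thesis by (rule that[OF w(1) uv(1)])
  qed
qed

lemma coverable_l_ge_2:
  assumes "3 \<le> r" "2 \<le> l" and K: "card K \<le> r + q * l"
  shows "coverable (Suc q)"
proof (rule ccontr)
  assume unc: "\<not> coverable (Suc q)"
  have unc1: "\<not> coverable 1" using unc coverable_mono by fastforce
  have "\<exists>S\<subseteq>V. S \<noteq> {} \<and> card S \<le> s \<and> card (agr S) \<le> card K - s * Suc q" if "2 \<le> s" for s
    using that
  proof (induction s rule: dec_induct)
    case base
    obtain u v where "u \<in> V" "v \<in> V" "card (agr {u, v}) + 2 * Suc q \<le> card K"
      by (rule far_pair[OF assms(1,2) unc])
    moreover have "card {u, v} \<le> 2" by (simp add: card_insert_if)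
    ultimately show ?case by (intro exI[of _ "{u, v}"]) auto
  next
    case (step s)
    then obtain S u where S: "S \<subseteq> V" "u \<in> S" "card S \<le> s" "card (agr S) \<le> card K - s * Suc q"
      by blast
    \<comment> \<open>If fewer than \<open>Suc q\<close> colours remain, all of them are removed;
      the truncated subtraction in the claim allows for this.\<close>
    obtain I where I: "I \<subseteq> agr S" "card I = min (Suc q) (card (agr S))"
      by (metis obtain_subset_with_card_n min.cobounded2)
    have "I \<subseteq> K" using I agr_sub by blast
    then obtain w where w: "w \<in> V" "\<And>i. i \<in> I \<Longrightarrow> p i w \<noteq> p i u"
      using uncovered_at[OF unc, of I u] I(2) S by auto
    have "agr (insert w S) \<subseteq> agr S - I" using w agr_insert[OF S(2)] by auto
    then have "card (agr (insert w S)) \<le> card (agr S) - card I"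
      using card_mono[of "agr S - I"] card_Diff_subset[of I "agr S"] I(1) finite_subset by fastforce
    then have "card (agr (insert w S)) \<le> card K - Suc s * Suc q" using S(4) I(2) by auto
    moreover have "card (insert w S) \<le> Suc s"
      using S(3) finite_subset[OF S(1) finite_V] by (simp add: card_insert_if)
    ultimately show ?case using S(1) w(1) by (intro exI[of _ "insert w S"]) auto
  qed
  from this[OF assms(2)] obtain S where S: "S \<subseteq> V" "S \<noteq> {}" "card S \<le> l" "card (agr S) \<le> card K - l * Suc q"
    by blast
  \<comment> \<open>Having at most \<open>l\<close> elements makes \<open>S\<close> a partial edge,
    whatever the classes of the chosen vertices are.\<close>
  then have "r < card (agr S) + card S"
    using card_agr[OF unc1 part_small] l_le_r by auto
  also have "\<dots> \<le> (card K - l * Suc q) + l" using S by simp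
  also have "\<dots> \<le> r" using K l_le_r by (auto simp: algebra_simps)
  finally show False by simp
qed

end

subsection \<open>One vertex per class\<close>

locale transversal_system = partite_system r l V cl K p
  for r l and V :: "'v set" and cl :: "'v \<Rightarrow> 'b" and K and p :: "nat \<Rightarrow> 'v \<Rightarrow> 'c" +
  assumes l_eq_1: "l = 1" and r_ge_3: "3 \<le> r"
begin

lemma part_iff: "part S \<longleftrightarrow> S \<subseteq> V \<and> inj_on cl S"
proof (cases "S \<subseteq> V")
  case True
  then have "finite {v \<in> S. cl v = c}" for c using finite_V finite_subset by fastforce
  then have "(card {v \<in> S. cl v = c} \<le> l) \<longleftrightarrow> (\<forall>a\<in>S. \<forall>b\<in>S. cl a = c \<longrightarrow> cl b = c \<longrightarrow> a = b)" for c
    unfolding l_eq_1 One_nat_def card_le_Suc0_iff_eq[OF \<open>finite {v \<in> S. cl v = c}\<close>] by blast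
  then show ?thesis using True unfolding part_def inj_on_def by simp blast
qed (simp add: part_def)

lemma part_insertI: "part S \<Longrightarrow> w \<in> V \<Longrightarrow> cl w \<notin> cl ` S \<Longrightarrow> part (insert w S)"
  unfolding part_iff by auto

lemma agr_hits_class:
  assumes "\<not> coverable 1" "part S" "u \<in> S" "w \<in> V" "cl w \<notin> cl ` S"
    and "I \<subseteq> agr S" "card (agr S - I) + card S < r"
  shows "\<exists>i\<in>I. p i w = p i u"
  using agr_hits[OF assms(1) part_insertI[OF assms(2,4,5)] _ assms(3,6,7)] assms(5) by auto

definition critical :: "'v set \<Rightarrow> nat \<Rightarrow> bool" where
  "critical e j \<longleftrightarrow> part e \<and> card e = r \<and> agr e = {j}"

definition odd_at :: "'v set \<Rightarrow> 'v \<Rightarrow> nat set" where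
  "odd_at e m = agr (e - {m}) - agr e"

lemma finite_odd_at [simp]: "finite (odd_at e m)"
  by (simp add: odd_at_def)

lemma odd_at_sub: "odd_at e m \<subseteq> K"
  using agr_sub by (auto simp: odd_at_def)

lemma critical_class:
  assumes "critical e j" "w \<in> V"
  obtains m where "m \<in> e" "cl w = cl m"
proof -
  have "part e" "card e = r" using assms by (auto simp: critical_def)
  then have "cl ` e = cl ` V"
    using finite_V card_classes
    by (intro card_subset_eq) (auto simp: part_iff card_image)
  then show thesis using that assms(2) by blast
qed

section \<open>Covers built around one critical edge\<close>

context
  fixes e j
  assumes unc1: "\<not> coverable 1" and crit: "critical e j"
begin

lemma crit_edge: "part e" "card e = r" "agr e = {j}" "finite e" "e \<subseteq> V"
  using crit part_finite part_subV by (auto simp: critical_def)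

lemma j_in: "j \<in> K"
  using crit_edge(3) agr_sub by blast

lemma card_minus: "m \<in> e \<Longrightarrow> card (e - {m}) = r - 1"
  using crit_edge by simp

lemma minus_nonempty: "e - {m} \<noteq> {}"
proof
  assume "e - {m} = {}"
  then have "card e \<le> card {m}" by (intro card_mono) auto
  then show False using crit_edge(2) r_ge_3 by simp
qed

lemma agr_minus: "agr (e - {m}) = insert j (odd_at e m)"
  using crit_edge(3) agr_antimono[of "e - {m}" e] by (auto simp: odd_at_def)

lemma j_notin: "j \<notin> odd_at e m"
  using crit_edge(3) by (auto simp: odd_at_def)

text \<open>By \<open>card_agr\<close> the \<open>r - 1\<close> remaining vertices agree in at least
  two colours, and only one of these can be \<open>j\<close>.\<close>

lemma odd_at_nonempty: "m \<in> e \<Longrightarrow> odd_at e m \<noteq> {}"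
proof
  assume m: "m \<in> e" "odd_at e m = {}"
  have "part (e - {m})" using part_subset[OF crit_edge(1)] by auto
  moreover have "e - {m} \<noteq> {}" by (rule minus_nonempty)
  ultimately have "r < card (agr (e - {m})) + (r - 1)"
    using card_agr[OF unc1, of "e - {m}"] card_minus[OF m(1)] by auto
  then show False using m(2) agr_minus r_ge_3 by auto
qed

lemma odd_at_pair:
  assumes "a \<in> e" "b \<in> e" "a \<noteq> b"
  shows "odd_at e a \<inter> agr {a, b} = {}"
proof -
  have "i \<in> agr e" if "i \<in> agr (e - {a})" "i \<in> agr {a, b}" for i
  proof -
    have "b \<in> e - {a}" using assms by auto
    then have "i \<in> agr (insert a (e - {a}))"
      using agr_insert[of b "e - {a}" a] that by (auto simp: agr_pair)
    then show ?thesis using assms by (simp add: insert_absorb)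
  qed
  then show ?thesis by (auto simp: odd_at_def)
qed

text \<open>With a third vertex \<open>c\<close> of \<open>e\<close>: in a colour of
  \<open>odd_at e b\<close> the vertices \<open>a\<close> and \<open>c\<close> agree, whereas in a
  colour of \<open>odd_at e a\<close> the vertex \<open>a\<close> agrees with no other vertex of
  \<open>e\<close>.\<close>

lemma odd_at_disjoint:
  assumes "a \<in> e" "b \<in> e" "a \<noteq> b"
  shows "odd_at e a \<inter> odd_at e b = {}"
proof -
  have "card {a, b} < card e" using assms crit_edge(2) r_ge_3 by simp
  then obtain c where c: "c \<in> e" "c \<noteq> a" "c \<noteq> b"
    using card_mono[of "{a, b}" e] by (auto simp: not_le)
  have "i \<in> agr {a, c}" if "i \<in> odd_at e b" for i
    using that agr_antimono[of "{a, c}" "e - {b}"] assms c by (auto simp: odd_at_def)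
  then show ?thesis using odd_at_pair[of a c] assms c by blast
qed

text \<open>Replacing \<open>m\<close> by a vertex \<open>w\<close> of its class gives an edge
  again, and the rest of \<open>e\<close> agrees exactly in \<open>j\<close> and in
  \<open>odd_at e m\<close>.\<close>

lemma cover_class:
  assumes "m \<in> e" "w \<in> V" "cl w = cl m" "n \<in> e" "n \<noteq> m"
  shows "\<exists>i \<in> insert j (odd_at e m). p i w = p i n"
proof -
  have "part (e - {m})" using part_subset[OF crit_edge(1)] by auto
  moreover have "cl w \<notin> cl ` (e - {m})"
    using assms crit_edge(1) by (auto simp: part_iff inj_on_def)
  ultimately show ?thesis
    using agr_hits_class[OF unc1, of "e - {m}" n w "agr (e - {m})"] assms card_minus[of m] agr_minus r_ge_3
    by auto
qed

text \<open>The classes of \<open>m\<close> and \<open>n\<close> are served by \<open>j\<close> and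
  the two odd sets, through \<open>cover_class\<close>. A vertex of any other class extends
  \<open>{m, n}\<close>, so it is caught by the common colours of \<open>m\<close> and
  \<open>n\<close>.\<close>

lemma split_cover:
  assumes mn: "m \<in> e" "n \<in> e" "m \<noteq> n"
  shows "coverable (card (agr {m, n}) + card (odd_at e m) + card (odd_at e n) - (r - 3))"
proof (rule ccontr)
  assume unc: "\<not> coverable (card (agr {m, n}) + card (odd_at e m) + card (odd_at e n) - (r - 3))"
  have pmn: "part {m, n}" using part_subset[OF crit_edge(1), of "{m, n}"] mn by auto
  then have big: "r < card (agr {m, n}) + 2"
    using card_agr[OF unc1, of "{m, n}"] mn r_ge_3 by auto
  have jmn: "j \<in> agr {m, n}" using crit_edge(3) agr_antimono[of "{m, n}" e] mn by auto
  \<comment> \<open>For a pair, \<open>agr_hits\<close> tolerates dropping \<open>r - 3\<close>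
    common colours, since \<open>(r - 3) + 2 < r\<close>. The colour \<open>j\<close> is kept
    because the classes of \<open>m\<close> and \<open>n\<close> need it.\<close>
  then have "r - 3 \<le> card (agr {m, n} - {j})" using big by simp
  then obtain D where D: "D \<subseteq> agr {m, n} - {j}" "card D = r - 3"
    by (metis obtain_subset_with_card_n)
  define I where "I = agr {m, n} - D"
  have finD: "finite D" using D(1) finite_subset by fastforce
  have cI: "card I = card (agr {m, n}) - (r - 3)"
    unfolding I_def using D card_Diff_subset[OF finD, of "agr {m, n}"] by auto
  have aI: "agr {m, n} - I = D" using D by (auto simp: I_def)
  let ?T = "(\<lambda>i. (i, m)) ` I \<union> (\<lambda>i. (i, n)) ` odd_at e m \<union> (\<lambda>i. (i, m)) ` odd_at e n"
  have finI: "finite I" by (auto simp: I_def)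
  have "card ?T \<le> card I + card (odd_at e m) + card (odd_at e n)"
    by (intro order_trans[OF card_Un_le] add_mono card_image_le finI finite_odd_at)
  then have cT: "card ?T \<le> card (agr {m, n}) + card (odd_at e m) + card (odd_at e n) - (r - 3)"
    using cI big by linarith
  have "I \<subseteq> K" using agr_sub by (auto simp: I_def)
  then have "?T \<subseteq> K \<times> V" using mn crit_edge(5) subsetD[OF odd_at_sub] by auto
  then obtain w where w: "w \<in> V" "\<And>i u. (i, u) \<in> ?T \<Longrightarrow> p i w \<noteq> p i u"
    using uncovered[OF unc _ cT] by metis
  have jI: "j \<in> I" using jmn D by (auto simp: I_def)
  have pj: "p j m = p j n" using jmn by (auto simp: agr_pair)
  show False
  proof (cases "cl w = cl m \<or> cl w = cl n")
    case True
    then consider "cl w = cl m" | "cl w = cl n" by auto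
    then show False
    proof cases
      case 1
      then show False using cover_class[OF mn(1) w(1) 1 mn(2)] mn w(2) jI pj by fastforce
    next
      case 2
      then show False using cover_class[OF mn(2) w(1) 2 mn(1)] mn w(2) jI pj by fastforce
    qed
  next
    case False
    then have "cl w \<notin> cl ` {m, n}" by auto
    moreover have "card (agr {m, n} - I) + card {m, n} < r" using aI D(2) mn(3) r_ge_3 by auto
    ultimately show False
      using agr_hits_class[OF unc1 pmn, of m w I] w by (auto simp: I_def)
  qed
qed

text \<open>The colours without a majority component: no component contains as many as
  \<open>r - 1\<close> vertices of \<open>e\<close>.\<close>

definition other :: "nat set" where
  "other = K - {j} - (\<Union>m\<in>e. odd_at e m)"

lemma finite_other [simp]: "finite other"
  using finite_K by (simp add: other_def)

lemma card_K: "card K = 1 + (\<Sum>m\<in>e. card (odd_at e m)) + card other"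
proof -
  let ?U = "\<Union>m\<in>e. odd_at e m"
  have K: "K = insert j (?U \<union> other)" using odd_at_sub j_in by (auto simp: other_def)
  have "j \<notin> ?U \<union> other" using j_notin by (auto simp: other_def)
  moreover have "?U \<inter> other = {}" by (auto simp: other_def)
  ultimately have "card (insert j (?U \<union> other)) = Suc (card ?U + card other)"
    using crit_edge(4) by (simp add: card_Un_disjoint)
  then have "card K = Suc (card ?U + card other)" using K by metis
  moreover have "card ?U = (\<Sum>m\<in>e. card (odd_at e m))"
    using crit_edge(4) odd_at_disjoint by (intro card_UN_disjoint) auto
  ultimately show ?thesis by simp
qed

lemma other_split:
  assumes "f \<in> other" "m \<in> e" "a \<in> e" "a \<noteq> m"
  obtains b where "b \<in> e" "b \<noteq> m" "p f b \<noteq> p f a"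
proof -
  have "f \<notin> agr (e - {m})" using assms(1,2) agr_minus[of m] by (auto simp: other_def)
  moreover have "f \<in> K" using assms(1) by (auto simp: other_def)
  ultimately obtain x y where "x \<in> e - {m}" "y \<in> e - {m}" "p f x \<noteq> p f y"
    unfolding agr_def by blast
  then show thesis using that[of x] that[of y] by (cases "p f x = p f a") auto
qed

text \<open>The sets \<open>agr {m, n}\<close>, \<open>odd_at e m\<close>, \<open>odd_at e n\<close>
  and \<open>F\<close> are pairwise disjoint, so every colour of \<open>F\<close> saves one
  component in \<open>split_cover\<close>. Two such colours give the sharp bound, one misses it by
  one.\<close>

lemma split_cover_other:
  assumes mn: "m \<in> e" "n \<in> e" and F: "F \<subseteq> other" "\<And>f. f \<in> F \<Longrightarrow> p f m \<noteq> p f n" "F \<noteq> {}"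
    and c: "card K + 3 \<le> c + r + card F"
  shows "coverable c"
proof -
  have "m \<noteq> n" using F(2,3) by auto
  let ?A = "agr {m, n}" and ?B = "odd_at e m" and ?C = "odd_at e n"
  have pmn: "part {m, n}" using part_subset[OF crit_edge(1), of "{m, n}"] mn by auto
  then have big: "r < card ?A + 2"
    using card_agr[OF unc1, of "{m, n}"] \<open>m \<noteq> n\<close> r_ge_3 by auto
  have finF: "finite F" by (rule finite_subset[OF F(1) finite_other])
  have "?A \<inter> ?B = {}" "?A \<inter> ?C = {}" "?B \<inter> ?C = {}"
    using odd_at_pair[OF mn \<open>m \<noteq> n\<close>] odd_at_pair[OF mn(2,1)] odd_at_disjoint[OF mn] \<open>m \<noteq> n\<close>
    by (auto simp: insert_commute)
  moreover have "F \<inter> ?B = {}" "F \<inter> ?C = {}" using F(1) mn by (auto simp: other_def)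
  moreover have "F \<inter> ?A = {}" using F(2) by (auto simp: agr_pair)
  ultimately have "card (?A \<union> ?B \<union> ?C \<union> F) = card ?A + card ?B + card ?C + card F"
    using finF by (subst card_Un_disjoint; (auto)?)+
  moreover have "?A \<union> ?B \<union> ?C \<union> F \<subseteq> K"
    using agr_sub odd_at_sub F(1) unfolding other_def by blast
  ultimately have "card ?A + card ?B + card ?C + card F \<le> card K"
    using card_mono[OF finite_K] by metis
  then have "card ?A + card ?B + card ?C - (r - 3) \<le> c" using c big r_ge_3 by linarith
  then show ?thesis using split_cover[OF mn \<open>m \<noteq> n\<close>] coverable_mono by blast
qed

text \<open>Two proper equivalence relations on \<open>e\<close> do not cover all pairs.\<close>

lemma two_others:
  assumes fg: "f \<in> other" "g \<in> other" "f \<noteq> g" and c: "card K + 1 \<le> c + r"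
  shows "coverable c"
proof -
  have split: "\<exists>y\<in>e. p h y \<noteq> p h x" if "h \<in> other" "x \<in> e" for h x
  proof -
    obtain m where "m \<in> e - {x}" using minus_nonempty by blast
    then show ?thesis using other_split[OF that(1), of m x] that(2) by auto
  qed
  obtain x where x: "x \<in> e" using minus_nonempty[of undefined] by blast
  obtain y z where yz: "y \<in> e" "p f y \<noteq> p f x" "z \<in> e" "p g z \<noteq> p g x"
    using split[OF fg(1) x] split[OF fg(2) x] by auto
  have "\<exists>m\<in>e. \<exists>n\<in>e. p f m \<noteq> p f n \<and> p g m \<noteq> p g n"
    using x yz by metis
  then obtain m n where mn: "m \<in> e" "n \<in> e" "p f m \<noteq> p f n" "p g m \<noteq> p g n" by auto
  show ?thesis
    by (rule split_cover_other[OF mn(1,2), of "{f, g}"]) (use fg mn c in auto)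
qed

lemma other_cover:
  assumes "f \<in> other" and c: "card K + 2 \<le> c + r"
  shows "coverable c"
proof -
  obtain m where m: "m \<in> e" using minus_nonempty[of undefined] by blast
  obtain a where a: "a \<in> e - {m}" using minus_nonempty by blast
  obtain b where "b \<in> e" "p f b \<noteq> p f a" using other_split[OF assms(1) m, of a] a by auto
  then show ?thesis
    by (intro split_cover_other[of b a "{f}"]) (use assms a in auto)
qed

text \<open>The majority components, except for the colours in \<^term>\<open>other\<close> and one colour
  of \<^term>\<open>odd_at e m\<close> for each of suitably many \<open>m\<close>, cover everything.\<close>

lemma majority_cover:
  assumes r4: "4 \<le> r" and few: "card other \<le> 1" and c: "card K + 1 \<le> c + r"
  shows "coverable c"
proof (rule ccontr)
  assume unc: "\<not> coverable c"
  \<comment> \<open>The size is chosen so that \<open>other\<close> and one odd colour for each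
    element of \<open>R\<close> make up \<open>r - 1\<close> dropped colours.\<close>
  obtain R where R: "R \<subseteq> e" "card R = r - 1 - card other"
    using crit_edge(2) by (metis obtain_subset_with_card_n diff_diff_left diff_le_self)
  define q where "q m = (SOME i. i \<in> odd_at e m)" for m
  have q: "q m \<in> odd_at e m" if "m \<in> e" for m
    using odd_at_nonempty[OF that] unfolding q_def by (simp add: some_in_eq)
  have inj: "inj_on q R"
  proof (rule inj_onI)
    fix a b assume "a \<in> R" "b \<in> R" "q a = q b"
    then show "a = b" using q[of a] q[of b] odd_at_disjoint[of a b] R(1) by auto
  qed
  have finR: "finite R" by (rule finite_subset[OF R(1) crit_edge(4)])
  define I where "I = K - other - q ` R"
  have "q ` R \<subseteq> K - other" using q R(1) odd_at_sub by (fastforce simp: other_def)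
  moreover have "card (K - other) = card K - card other"
    using finite_K by (intro card_Diff_subset) (auto simp: other_def)
  ultimately have "card I = card K - card other - (r - 1 - card other)"
    unfolding I_def using finR by (subst card_Diff_subset) (auto simp: card_image inj R(2))
  then have cI: "card I \<le> c" using c few r4 by linarith
  \<comment> \<open>In a colour that is odd at no vertex every choice passes; among the colours of
    \<open>I\<close> this happens only for \<open>j\<close>, where all of \<open>e\<close>
    agrees.\<close>
  define maj where "maj i = (SOME u. u \<in> e \<and> (\<forall>m\<in>e. i \<in> odd_at e m \<longrightarrow> u \<noteq> m))" for i
  have maj: "maj i \<in> e \<and> (\<forall>m\<in>e. i \<in> odd_at e m \<longrightarrow> maj i \<noteq> m)" for i
  proof -
    have "\<exists>u. u \<in> e \<and> (\<forall>m\<in>e. i \<in> odd_at e m \<longrightarrow> u \<noteq> m)"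
    proof (cases "\<exists>m\<in>e. i \<in> odd_at e m")
      case True
      then obtain m where m: "m \<in> e" "i \<in> odd_at e m" by auto
      obtain u where "u \<in> e - {m}" using minus_nonempty by blast
      then show ?thesis using odd_at_disjoint m by blast
    next
      case False
      then show ?thesis using minus_nonempty[of undefined] by blast
    qed
    then show ?thesis unfolding maj_def by (rule someI_ex)
  qed
  have IK: "I \<subseteq> K" by (auto simp: I_def)
  have majV: "maj i \<in> V" for i using maj crit_edge(5) by blast
  obtain w where w: "w \<in> V" "\<And>i. i \<in> I \<Longrightarrow> p i w \<noteq> p i (maj i)"
    by (rule uncovered_map[OF unc IK cI, of maj]) (use majV in blast)+
  obtain m where m: "m \<in> e" "cl w = cl m" using critical_class[OF crit w(1)] by auto
  have maj_agr: "p i (maj i) = p i a" if "a \<in> e" "b \<in> e" "a \<noteq> b" "i \<in> agr {a, b}" "i \<notin> other" for a b i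
  proof (cases "\<exists>n\<in>e. i \<in> odd_at e n")
    case True
    then obtain n where n: "n \<in> e" "i \<in> odd_at e n" by auto
    then have "n \<noteq> a" "n \<noteq> b"
      using odd_at_pair[OF that(1-3)] odd_at_pair[OF that(2,1)] that(3,4) by (auto simp: insert_commute)
    then show ?thesis
      using agrD[of i "e - {n}" "maj i" a] n maj[of i] that(1) by (auto simp: odd_at_def)
  next
    case False
    then have "i \<in> agr e" using that(4,5) agr_sub crit_edge(3) by (auto simp: other_def)
    then show ?thesis using agrD[of i e] maj that(1) by blast
  qed
  have contra: False
    if ab: "a \<in> e" "b \<in> e" "a \<noteq> b" "a \<noteq> m" "b \<noteq> m"
      and few: "card ((other \<union> q ` R) \<inter> agr {a, b}) + 2 < r" for a b
  proof -
    have "part {a, b}" using part_subset[OF crit_edge(1), of "{a, b}"] ab by auto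
    moreover have "cl w \<notin> cl ` {a, b}"
      using m ab crit_edge(1) by (auto simp: part_iff inj_on_def)
    moreover have "agr {a, b} - (agr {a, b} \<inter> I) = (other \<union> q ` R) \<inter> agr {a, b}"
      using agr_sub by (auto simp: I_def)
    ultimately obtain i where "i \<in> agr {a, b} \<inter> I" "p i w = p i a"
      using agr_hits_class[OF unc1, of "{a, b}" a w "agr {a, b} \<inter> I"] few ab(3) w(1) by auto
    then show False using maj_agr[of a b i] w(2)[of i] ab by (auto simp: I_def)
  qed
  have q_notin: "q a \<notin> agr {a, b}" if "a \<in> e" "b \<in> e" "a \<noteq> b" for a b
    using odd_at_pair[OF that] q[OF that(1)] by auto
  \<comment> \<open>Here \<open>4 \<le> r\<close> is needed: after the loss of \<open>m\<close>
    there must still be enough vertices of \<open>R\<close> to form a pair \<open>a\<close>,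
    \<open>b\<close> whose agreement avoids two dropped colours. These are \<open>q a\<close> and
    \<open>q b\<close> if \<open>other\<close> is empty, and otherwise \<open>q a\<close> and the
    colour \<open>f\<close> that separates \<open>a\<close> from \<open>b\<close>. At most
    \<open>r - 3\<close> dropped colours remain in \<open>agr {a, b}\<close>, as
    \<open>contra\<close> requires.\<close>
  have cRm: "2 \<le> card (R - {m}) + card other"
    using R(2) few r4 finR by (auto simp: card_Diff_singleton_if)
  show False
  proof (cases "other = {}")
    case True
    then have "\<not> card (R - {m}) \<le> Suc 0" using cRm by simp
    then obtain a b where ab: "a \<in> R - {m}" "b \<in> R - {m}" "a \<noteq> b"
      using card_le_Suc0_iff_eq[of "R - {m}"] finR by blast
    have "(other \<union> q ` R) \<inter> agr {a, b} \<subseteq> q ` (R - {a, b})"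
      using True q_notin[of a b] q_notin[of b a] ab R(1) by (auto simp: insert_commute)
    then have "card ((other \<union> q ` R) \<inter> agr {a, b}) \<le> card (R - {a, b})"
      using finR by (meson card_image_le card_mono finite_Diff finite_imageI le_trans)
    also have "\<dots> = r - 1 - 2" using ab finR R(2) True by (simp add: card_Diff_subset)
    finally have "card ((other \<union> q ` R) \<inter> agr {a, b}) + 2 < r" using r4 by linarith
    then show False using contra[of a b] ab R(1) by blast
  next
    case False
    then have o1: "card other = 1" using few by (simp add: le_Suc_eq)
    then obtain f where f: "other = {f}" by (auto simp: card_1_singleton_iff)
    have "card (R - {m}) \<noteq> 0" using cRm o1 by simp
    then have "R - {m} \<noteq> {}" by (metis card.empty)
    then obtain a where a: "a \<in> R" "a \<noteq> m" by auto
    then obtain b where b: "b \<in> e" "b \<noteq> m" "p f b \<noteq> p f a"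
      using other_split[of f m a] f m(1) R(1) by auto
    then have "a \<noteq> b" by auto
    have "(other \<union> q ` R) \<inter> agr {a, b} \<subseteq> q ` (R - {a})"
      using f b(3) q_notin[of a b] a b(1) R(1) \<open>a \<noteq> b\<close> by (auto simp: agr_pair)
    then have "card ((other \<union> q ` R) \<inter> agr {a, b}) \<le> card (R - {a})"
      using finR by (meson card_image_le card_mono finite_Diff finite_imageI le_trans)
    also have "\<dots> = r - 3" using a finR R(2) o1 by simp
    finally have "card ((other \<union> q ` R) \<inter> agr {a, b}) + 2 < r" using r4 by linarith
    then show False using contra[of a b] a b R(1) \<open>a \<noteq> b\<close> by blast
  qed
qed

lemma cover_r_ge_4:
  assumes "4 \<le> r" "card K + 1 \<le> c + r"
  shows "coverable c"
proof (cases "card other \<le> 1")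
  case True
  then show ?thesis using majority_cover assms by blast
next
  case False
  then obtain f g where "f \<in> other" "g \<in> other" "f \<noteq> g"
    using card_le_Suc0_iff_eq[OF finite_other] by auto
  then show ?thesis using two_others assms(2) by blast
qed

end

subsection \<open>Three classes\<close>

lemma agr_triple: "agr {x, y, z} = {i \<in> K. p i x = p i y \<and> p i y = p i z}"
  using agr_insert[of y "{y, z}" x] by (auto simp: agr_pair)

lemma part_triple:
  "\<lbrakk>x \<in> V; y \<in> V; z \<in> V; cl x \<noteq> cl y; cl x \<noteq> cl z; cl y \<noteq> cl z\<rbrakk> \<Longrightarrow> part {x, y, z}"
  by (auto simp: part_iff)

lemma triple_agree:
  assumes "r = 3" "x \<in> V" "y \<in> V" "z \<in> V" "cl x \<noteq> cl y" "cl x \<noteq> cl z" "cl y \<noteq> cl z"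
  shows "\<exists>i\<in>K. p i x = p i y \<and> p i y = p i z"
proof -
  have "x \<noteq> y" "x \<noteq> z" "y \<noteq> z" using assms(5-7) by auto
  then have "card {x, y, z} = r" using assms(1) by simp
  then show ?thesis
    using agr_edge[OF part_triple[OF assms(2-)]] unfolding agr_triple by blast
qed

text \<open>This is \<open>card_agr\<close> for two vertices,
  \<open>3 < card (agr {x, y}) + 2\<close>, in a form that can be expanded over an explicit list of
  colours.\<close>

lemma pair_agree:
  assumes "r = 3" "\<not> coverable 1" "x \<in> V" "y \<in> V" "cl x \<noteq> cl y"
  shows "\<exists>i\<in>K. \<exists>i'\<in>K. i \<noteq> i' \<and> p i x = p i y \<and> p i' x = p i' y"
proof -
  have "x \<noteq> y" using assms(5) by auto
  then have "part {x, y}" "card {x, y} = 2" using assms(3-5) by (auto simp: part_iff)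
  then have "\<not> card (agr {x, y}) \<le> Suc 0" using card_agr[OF assms(2), of "{x, y}"] assms(1) by auto
  then show ?thesis using card_le_Suc0_iff_eq[OF finite_agr, of "{x, y}"] by (auto simp: agr_pair)
qed

lemma critical_tripleI:
  assumes "r = 3" "x \<in> V" "y \<in> V" "z \<in> V" "cl x \<noteq> cl y" "cl x \<noteq> cl z" "cl y \<noteq> cl z"
    and "agr {x, y, z} = {i}"
  shows "critical {x, y, z} i"
proof -
  have "x \<noteq> y" "x \<noteq> z" "y \<noteq> z" using assms(5-7) by auto
  then have "card {x, y, z} = r" using assms(1) by simp
  then show ?thesis using part_triple[OF assms(2-7)] assms(8) unfolding critical_def by blast
qed

lemma odd_at_triple:
  assumes "x \<noteq> y" "x \<noteq> z"
  shows "odd_at {x, y, z} x = {i \<in> K. p i y = p i z \<and> p i x \<noteq> p i y}"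
proof -
  have "{x, y, z} - {x} = {y, z}" using assms by auto
  then show ?thesis by (auto simp: odd_at_def agr_triple agr_pair)
qed

lemma other_triple:
  assumes unc1: "\<not> coverable 1" and crit: "critical {x, y, z} j" and "x \<noteq> y" "x \<noteq> z" "y \<noteq> z"
  shows "other {x, y, z} j = {i \<in> K. p i x \<noteq> p i y \<and> p i x \<noteq> p i z \<and> p i y \<noteq> p i z}"
proof -
  have "{x, y, z} = {y, x, z}" "{x, y, z} = {z, x, y}" by auto
  then have odd: "odd_at {x, y, z} y = {i \<in> K. p i x = p i z \<and> p i y \<noteq> p i x}"
    "odd_at {x, y, z} z = {i \<in> K. p i x = p i y \<and> p i z \<noteq> p i x}"
    using odd_at_triple[of y x z] odd_at_triple[of z x y] assms(3-5) by auto
  have J: "i = j \<longleftrightarrow> p i x = p i y \<and> p i y = p i z" if "i \<in> K" for i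
  proof -
    have "i \<in> agr {x, y, z} \<longleftrightarrow> i = j" using crit unfolding critical_def by blast
    then show ?thesis using that unfolding agr_triple by blast
  qed
  show ?thesis
  proof (rule set_eqI)
    fix i
    show "i \<in> other {x, y, z} j \<longleftrightarrow> i \<in> {i \<in> K. p i x \<noteq> p i y \<and> p i x \<noteq> p i z \<and> p i y \<noteq> p i z}"
      using J[of i] unfolding other_def[OF unc1 crit] by (simp add: odd odd_at_triple[OF assms(3,4)]) metis
  qed
qed

lemma class_cases:
  assumes r3: "r = 3" and "u1 \<in> V" "u2 \<in> V" "u3 \<in> V"
    and "cl u1 \<noteq> cl u2" "cl u1 \<noteq> cl u3" "cl u2 \<noteq> cl u3" and "w \<in> V"
  shows "cl w = cl u1 \<or> cl w = cl u2 \<or> cl w = cl u3"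
proof -
  have "{cl u1, cl u2, cl u3} = cl ` V"
    using assms card_classes finite_V by (intro card_subset_eq) auto
  then show ?thesis using assms(8) by blast
qed

lemma uncovered3:
  assumes "\<not> coverable 3" "i1 \<in> K" "i2 \<in> K" "i3 \<in> K" "v1 \<in> V" "v2 \<in> V" "v3 \<in> V"
  obtains w where "w \<in> V" "p i1 w \<noteq> p i1 v1" "p i2 w \<noteq> p i2 v2" "p i3 w \<noteq> p i3 v3"
proof (rule uncovered[OF assms(1), of "{(i1, v1), (i2, v2), (i3, v3)}"])
  show "card {(i1, v1), (i2, v2), (i3, v3)} \<le> 3" by (simp add: card_insert_if)
qed (use assms that in auto)

text \<open>The components to be avoided by \<open>z, y, x, v, t, s\<close>, and the pairs and triples of vertices
  that refute each class for such a vertex, were found by a computer search.\<close>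

lemma five_colours_aux:
  assumes r3: "r = 3" and unc: "\<not> coverable 3"
    and uV: "u1 \<in> V" "u2 \<in> V" "u3 \<in> V"
    and cl: "cl u1 \<noteq> cl u2" "cl u1 \<noteq> cl u3" "cl u2 \<noteq> cl u3"
    and K: "K = {j, a, b, c, f}"
    and pat: "p j u1 = p j u3" "p j u2 = p j u3" "p a u2 = p a u3" "p a u1 \<noteq> p a u3"
      "p b u1 = p b u3" "p b u2 \<noteq> p b u3" "p c u1 = p c u2" "p c u3 \<noteq> p c u2"
      "p f u1 \<noteq> p f u2" "p f u1 \<noteq> p f u3" "p f u2 \<noteq> p f u3"
    and w: "w \<in> V" "cl w = cl u2" "p j w \<noteq> p j u1" "p a w \<noteq> p a u1" "p a w \<noteq> p a u2"
  shows False
proof -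
  have unc1: "\<not> coverable 1" using unc coverable_mono by fastforce
  \<comment> \<open>With the five colours listed, \<open>T\<close> and \<open>P\<close> become
    disjunctions of equalities between component names, so refuting a class is a finite case
    check.\<close>
  note T = triple_agree[OF r3, unfolded K bex_simps, simplified]
  note P = pair_agree[OF r3 unc1, unfolded K bex_simps, simplified]
  note cls = class_cases[OF r3 uV cl]
  obtain z where z: "z \<in> V" "p j z \<noteq> p j u1" "p a z \<noteq> p a u2" "p b z \<noteq> p b u1"
    by (rule uncovered3[OF unc, of j a b u1 u2 u1]) (use uV K in auto)
  obtain y where y: "y \<in> V" "p j y \<noteq> p j u1" "p a y \<noteq> p a u2" "p c y \<noteq> p c u1"
    by (rule uncovered3[OF unc, of j a c u1 u2 u1]) (use uV K in auto)
  obtain x where x: "x \<in> V" "p j x \<noteq> p j u1" "p b x \<noteq> p b u1" "p c x \<noteq> p c u1"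
    by (rule uncovered3[OF unc, of j b c u1 u1 u1]) (use uV K in auto)
  \<comment> \<open>Two of \<open>u1\<close>, \<open>u2\<close>, \<open>u3\<close> agree only in
    \<open>j\<close> and one further colour: \<open>a\<close> for \<open>u2\<close>,
    \<open>u3\<close>, \<open>b\<close> for \<open>u1\<close>, \<open>u3\<close>, and
    \<open>c\<close> for \<open>u1\<close>, \<open>u2\<close>. A vertex avoiding both components of
    a pair is not in the third class; each of \<open>z\<close>, \<open>y\<close>, \<open>x\<close>
    does so for two pairs, which fixes its class.\<close>
  have cz: "cl z = cl u3" using cls[OF z(1)] T[of u2 u3 z] T[of u1 u3 z] z uV cl pat by (smt (verit))
  have cy: "cl y = cl u2" using cls[OF y(1)] T[of u2 u3 y] T[of u1 u2 y] y uV cl pat by (smt (verit))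
  have cx: "cl x = cl u1" using cls[OF x(1)] T[of u1 u3 x] T[of u1 u2 x] x uV cl pat by (smt (verit))
  note base = uV cl pat w z y x cz cy cx
  obtain v where v: "v \<in> V" "p j v \<noteq> p j u1" "p a v \<noteq> p a u2" "p f v \<noteq> p f u1"
    by (rule uncovered3[OF unc, of j a f u1 u2 u1]) (use uV K in auto)
  have "cl v \<noteq> cl u1" using T[of u2 u3 v] v uV cl pat by (smt (verit))
  then consider "cl v = cl u2" | "cl v = cl u3" using cls[OF v(1)] by auto
  then show False
  proof cases
    case 1
    obtain t where t: "t \<in> V" "p j t \<noteq> p j u1" "p b t \<noteq> p b u1" "p b t \<noteq> p b u2"
      by (rule uncovered3[OF unc, of j b b u1 u1 u2]) (use uV K in auto)
    have "cl t \<noteq> cl u2" using T[of u1 u3 t] t uV cl pat by (smt (verit))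
    then consider "cl t = cl u1" | "cl t = cl u3" using cls[OF t(1)] by auto
    then show False
    proof cases
      case t1: 1
      obtain s where s: "s \<in> V" "p a s \<noteq> p a u2" "p a s \<noteq> p a u1" "p f s \<noteq> p f u3"
        by (rule uncovered3[OF unc, of a a f u2 u1 u3]) (use uV K in auto)
      have "cl s \<noteq> cl u1"
        using T[of u1 u3 y] T[of u1 z y] T[of u1 z w] T[of u2 u3 s] T[of u2 z t] T[of u3 y t] T[of u3 w t] T[of z y s]
          base v 1 t t1 s by (smt (verit))
      moreover have "cl s \<noteq> cl u2"
        using T[of u1 z s] T[of u2 z t] T[of u3 t s]
          base v 1 t t1 s by (smt (verit))
      moreover have "cl s \<noteq> cl u3"
        using P[of u1 y] P[of u2 x] P[of y s] P[of x s] T[of u1 z w] T[of u2 z t] T[of u2 t s] T[of u3 y t] T[of u3 x w] T[of u3 w t]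
          base v 1 t t1 s by (smt (verit))
      ultimately show False using cls[OF s(1)] by blast
    next
      case t3: 2
      obtain s where s: "s \<in> V" "p a s \<noteq> p a u2" "p b s \<noteq> p b u1" "p b s \<noteq> p b u2"
        by (rule uncovered3[OF unc, of a b b u2 u1 u2]) (use uV K in auto)
      have "cl s \<noteq> cl u1"
        using T[of u1 y t] T[of u1 w t] T[of u2 x t] T[of u2 t s] T[of u3 y s] T[of u3 x w]
          base v 1 t t3 s by (smt (verit))
      moreover have "cl s \<noteq> cl u2"
        using P[of u1 w] P[of u1 t] P[of u2 x] P[of u2 t] P[of w t] P[of v t] T[of u1 u3 v] T[of u1 u3 s] T[of u3 x w] T[of u3 x v] T[of x t s]
          base v 1 t t3 s by (smt (verit))
      moreover have "cl s \<noteq> cl u3"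
        using T[of u1 w s] T[of u2 x s] T[of u3 x w]
          base v 1 t t3 s by (smt (verit))
      ultimately show False using cls[OF s(1)] by blast
    qed
  next
    case 2
    obtain t where t: "t \<in> V" "p b t \<noteq> p b u1" "p b t \<noteq> p b u2" "p f t \<noteq> p f u3"
      by (rule uncovered3[OF unc, of b b f u1 u2 u3]) (use uV K in auto)
    have "cl t \<noteq> cl u1"
      using T[of u1 z w] T[of u2 z t] T[of u3 w t]
        base v 2 t by (smt (verit))
    moreover have "cl t \<noteq> cl u2"
      using P[of u2 z] T[of u1 u3 t] T[of u1 z w] T[of u1 w v] T[of u2 u3 x] T[of u2 x v] T[of u3 x w] T[of z x t]
        base v 2 t by (smt (verit))
    ultimately have t3: "cl t = cl u3" using cls[OF t(1)] by blast
    obtain s where s: "s \<in> V" "p a s \<noteq> p a u2" "p b s \<noteq> p b u1" "p b s \<noteq> p b u2"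
      by (rule uncovered3[OF unc, of a b b u2 u1 u2]) (use uV K in auto)
    have "cl s \<noteq> cl u1"
      using P[of u1 y] P[of u3 y] T[of u1 z w] T[of u2 u3 s] T[of u2 z s] T[of u2 x t] T[of u3 x w] T[of u3 w s] T[of y t s]
        base v 2 t t3 s by (smt (verit))
    moreover have "cl s \<noteq> cl u2"
      using P[of u1 t] P[of u2 z] P[of u2 x] P[of u3 x] P[of w t] T[of u1 u2 v] T[of u1 u3 w] T[of u1 u3 s] T[of u1 z w] T[of u3 x w] T[of z x s] T[of x v s] T[of x t s]
        base v 2 t t3 s by (smt (verit))
    moreover have "cl s \<noteq> cl u3"
      using T[of u1 w s] T[of u2 x s] T[of u3 x w]
        base v 2 t t3 s by (smt (verit))
    ultimately show False using cls[OF s(1)] by blast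
  qed
qed

text \<open>The vertex \<open>w\<close> avoids the components shared by \<open>u2\<close> and
  \<open>u3\<close>, so it is not in the class of \<open>u1\<close>. The two classes left are
  interchanged by swapping \<open>u2\<close> with \<open>u3\<close> and \<open>b\<close> with
  \<open>c\<close>.\<close>

lemma five_colours:
  assumes r3: "r = 3" and unc: "\<not> coverable 3"
    and uV: "u1 \<in> V" "u2 \<in> V" "u3 \<in> V"
    and cl: "cl u1 \<noteq> cl u2" "cl u1 \<noteq> cl u3" "cl u2 \<noteq> cl u3"
    and K: "K = {j, a, b, c, f}"
    and pat: "p j u1 = p j u3" "p j u2 = p j u3" "p a u2 = p a u3" "p a u1 \<noteq> p a u3"
      "p b u1 = p b u3" "p b u2 \<noteq> p b u3" "p c u1 = p c u2" "p c u3 \<noteq> p c u2"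
      "p f u1 \<noteq> p f u2" "p f u1 \<noteq> p f u3" "p f u2 \<noteq> p f u3"
  shows False
proof -
  obtain w where w: "w \<in> V" "p j w \<noteq> p j u1" "p a w \<noteq> p a u1" "p a w \<noteq> p a u2"
    by (rule uncovered3[OF unc, of j a a u1 u1 u2]) (use uV K in auto)
  have "cl w \<noteq> cl u1"
    using triple_agree[OF r3, of u2 u3 w, unfolded K bex_simps, simplified] w uV cl pat by (smt (verit))
  then consider "cl w = cl u2" | "cl w = cl u3" using class_cases[OF r3 uV cl w(1)] by auto
  then show False
  proof cases
    case 1
    then show False by (intro five_colours_aux[OF r3 unc uV cl K pat w(1) _ w(2-4)])
  next
    case 2
    show False
      by (rule five_colours_aux[OF r3 unc, of u1 u3 u2 j a c b f w]) (use uV cl K pat w 2 in auto)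
  qed
qed

text \<open>A triple with exactly one common colour is critical, and a colour separating all three
  vertices would then lie in \<open>other\<close>. So such a separating colour forces a second
  common colour.\<close>

lemma no_rainbow:
  assumes r3: "r = 3" and unc1: "\<not> coverable 1"
    and none: "\<forall>e j. critical e j \<longrightarrow> other e j = {}"
    and xyz: "x \<in> V" "y \<in> V" "z \<in> V" "cl x \<noteq> cl y" "cl x \<noteq> cl z" "cl y \<noteq> cl z"
    and i: "i \<in> K" "p i x \<noteq> p i y" "p i x \<noteq> p i z" "p i y \<noteq> p i z"
  shows "\<exists>i1\<in>K. \<exists>i2\<in>K. i1 \<noteq> i2 \<and> (p i1 x = p i1 y \<and> p i1 y = p i1 z) \<and>
           p i2 x = p i2 y \<and> p i2 y = p i2 z"
proof (rule ccontr)
  assume neg: "\<not> ?thesis"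
  obtain j where j: "j \<in> agr {x, y, z}" using triple_agree[OF r3 xyz] by (auto simp: agr_triple)
  moreover have "i' = j" if "i' \<in> agr {x, y, z}" for i'
    using neg j that unfolding agr_triple by blast
  ultimately have "agr {x, y, z} = {j}" by blast
  then have "critical {x, y, z} j" by (rule critical_tripleI[OF r3 xyz])
  moreover from this have "i \<in> other {x, y, z} j"
    using other_triple[OF unc1, of x y z j] xyz(4-6) i by auto
  ultimately show False using none by blast
qed

lemma double_colour_aux:
  assumes r3: "r = 3" and unc: "\<not> coverable 3"
    and none: "\<forall>e j. critical e j \<longrightarrow> other e j = {}"
    and uV: "u1 \<in> V" "u2 \<in> V" "u3 \<in> V"
    and cl: "cl u1 \<noteq> cl u2" "cl u1 \<noteq> cl u3" "cl u2 \<noteq> cl u3"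
    and K: "K = {j, a, d, b, c}"
    and pat: "p j u1 = p j u3" "p j u2 = p j u3" "p a u2 = p a u3" "p a u1 \<noteq> p a u3"
      "p d u2 = p d u3" "p d u1 \<noteq> p d u3"
      "p b u1 = p b u3" "p b u2 \<noteq> p b u3" "p c u1 = p c u2" "p c u3 \<noteq> p c u2"
    and y: "y \<in> V" "cl y = cl u2" "p j y \<noteq> p j u3" "p a y \<noteq> p a u3" "p d y \<noteq> p d u3"
  shows False
proof -
  have unc1: "\<not> coverable 1" using unc coverable_mono by fastforce
  note T = triple_agree[OF r3, unfolded K bex_simps, simplified]
  note P = pair_agree[OF r3 unc1, unfolded K bex_simps, simplified]
  note N = no_rainbow[OF r3 unc1 none, unfolded K bex_simps, simplified]
  \<comment> \<open>In colour \<open>d\<close> the vertex \<open>w\<close> introduces a third value,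
    so \<open>no_rainbow\<close> applies to triples of \<open>w\<close>, \<open>u1\<close> and one
    of \<open>u2\<close>, \<open>u3\<close>.\<close>
  obtain w where w: "w \<in> V" "p j w \<noteq> p j u3" "p d w \<noteq> p d u1" "p d w \<noteq> p d u3"
    by (rule uncovered3[OF unc, of j d d u3 u1 u3]) (use uV K in auto)
  note base = uV cl pat y w
  \<comment> \<open>As \<open>u1\<close> and \<open>u3\<close> agree only in \<open>j\<close> and
    \<open>b\<close> while \<open>y\<close> avoids their component of \<open>j\<close>, the triple
    \<open>u1\<close>, \<open>y\<close>, \<open>u3\<close> has \<open>b\<close> as its only common
    colour. By \<open>no_rainbow\<close> no colour separates it, which determines \<open>y\<close>
    in \<open>a\<close> and \<open>d\<close>; the second agreement of \<open>y\<close> and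
    \<open>u3\<close> can then only be \<open>c\<close>.\<close>
  have yb: "p b y = p b u3" using T[of u1 u3 y] base by (smt (verit))
  have ya: "p a y = p a u1" using N[of u1 y u3 a] base by (smt (verit))
  have yd: "p d y = p d u1" using N[of u1 y u3 d] base by (smt (verit))
  have yc: "p c y = p c u3" using P[of y u3] base by (smt (verit))
  have "cl w \<noteq> cl u1"
  proof
    assume cw: "cl w = cl u1"
    have "p a w = p a u3" using T[of u2 u3 w] base cw by (smt (verit))
    then show False
      using N[of w y u3 d] N[of w u2 u3 b] N[of w u2 u3 c] T[of w y u3] P[of w u2] P[of w u3]
        base ya yb yc yd cw by (smt (verit))
  qed
  moreover have "cl w \<noteq> cl u2"
    using T[of u1 u3 w] N[of u1 w u3 d] base by (smt (verit))
  moreover have "cl w \<noteq> cl u3"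
    using T[of u1 u2 w] N[of u1 u2 w d] base by (smt (verit))
  ultimately show False using class_cases[OF r3 uV cl w(1)] by blast
qed

text \<open>Five colours with odd sets of sizes 2, 1, 1. Again one class is excluded for
  \<open>y\<close>, and swapping \<open>u2\<close> with \<open>u3\<close> and \<open>b\<close> with
  \<open>c\<close> interchanges the others.\<close>

lemma double_colour:
  assumes r3: "r = 3" and unc: "\<not> coverable 3"
    and none: "\<forall>e j. critical e j \<longrightarrow> other e j = {}"
    and uV: "u1 \<in> V" "u2 \<in> V" "u3 \<in> V"
    and cl: "cl u1 \<noteq> cl u2" "cl u1 \<noteq> cl u3" "cl u2 \<noteq> cl u3"
    and K: "K = {j, a, d, b, c}"
    and pat: "p j u1 = p j u3" "p j u2 = p j u3" "p a u2 = p a u3" "p a u1 \<noteq> p a u3"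
      "p d u2 = p d u3" "p d u1 \<noteq> p d u3"
      "p b u1 = p b u3" "p b u2 \<noteq> p b u3" "p c u1 = p c u2" "p c u3 \<noteq> p c u2"
  shows False
proof -
  obtain y where y: "y \<in> V" "p j y \<noteq> p j u3" "p a y \<noteq> p a u3" "p d y \<noteq> p d u3"
    by (rule uncovered3[OF unc, of j a d u3 u3 u3]) (use uV K in auto)
  have "cl y \<noteq> cl u1"
    using triple_agree[OF r3, of u2 u3 y, unfolded K bex_simps, simplified] y uV cl pat by (smt (verit))
  then consider "cl y = cl u2" | "cl y = cl u3" using class_cases[OF r3 uV cl y(1)] by auto
  then show False
  proof cases
    case 1
    show False
      by (rule double_colour_aux[OF r3 unc none uV cl K pat y(1) 1 y(2-4)])
  next
    case 2
    show False
      by (rule double_colour_aux[OF r3 unc none, of u1 u3 u2 j a d c b y])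
        (use uV cl K pat y 2 in auto)
  qed
qed

section \<open>Three classes and four colours\<close>

lemma uncovered2:
  assumes "\<not> coverable 2" "i1 \<in> K" "i2 \<in> K" "v1 \<in> V" "v2 \<in> V"
  obtains w where "w \<in> V" "p i1 w \<noteq> p i1 v1" "p i2 w \<noteq> p i2 v2"
proof (rule uncovered[OF assms(1), of "{(i1, v1), (i2, v2)}"])
  show "card {(i1, v1), (i2, v2)} \<le> 2" by (simp add: card_insert_if)
qed (use assms that in auto)

text \<open>In \<open>a\<close>, \<open>b\<close>, \<open>c\<close> each \<open>u\<close> has the
  odd value in one colour and the majority value in the other two. The hypotheses force
  \<open>x\<close> and \<open>z\<close> to be the complements of \<open>u1\<close> and
  \<open>u3\<close> there, and a vertex \<open>w\<close> with a third value in \<open>b\<close> then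
  fits into no class.\<close>

lemma four_colours_aux:
  assumes r3: "r = 3" and unc: "\<not> coverable 2"
    and none: "\<forall>e j. critical e j \<longrightarrow> other e j = {}"
    and uV: "u1 \<in> V" "u2 \<in> V" "u3 \<in> V"
    and cl: "cl u1 \<noteq> cl u2" "cl u1 \<noteq> cl u3" "cl u2 \<noteq> cl u3"
    and K: "K = {j, a, b, c}"
    and pat: "p j u1 = p j u3" "p j u2 = p j u3" "p a u2 = p a u3" "p a u1 \<noteq> p a u3"
      "p b u1 = p b u3" "p b u2 \<noteq> p b u3" "p c u1 = p c u2" "p c u3 \<noteq> p c u2"
    and x: "x \<in> V" "cl x = cl u1" "p j x \<noteq> p j u3" "p b x \<noteq> p b u3 \<or> p c x \<noteq> p c u2"
    and z: "z \<in> V" "cl z = cl u3" "p j z \<noteq> p j u3" "p a z \<noteq> p a u3 \<or> p b z \<noteq> p b u3"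
  shows False
proof -
  have unc1: "\<not> coverable 1" using unc coverable_mono by fastforce
  note T = triple_agree[OF r3, unfolded K bex_simps, simplified]
  note P = pair_agree[OF r3 unc1, unfolded K bex_simps, simplified]
  note N = no_rainbow[OF r3 unc1 none, unfolded K bex_simps, simplified]
  obtain w where w: "w \<in> V" "p b w \<noteq> p b u1" "p b w \<noteq> p b u2"
    by (rule uncovered2[OF unc, of b b u1 u2]) (use uV K in auto)
  note base = uV cl pat x z w
  have x': "p a x = p a u3" "p b x = p b u2" "p c x = p c u3"
    using T[of x u2 u3] N[of x u2 u3 b] N[of x u2 u3 c] P[of x u2] P[of x u3] base by (smt (verit))+
  have z': "p c z = p c u1" "p b z = p b u2" "p a z = p a u1"
    using T[of u1 u2 z] N[of u1 u2 z b] N[of u1 u2 z a] P[of z u1] P[of z u2] base by (smt (verit))+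
  have "cl w \<noteq> cl u1"
    using T[of w u2 u3] N[of w u2 u3 b] P[of w z] base x' z' by (smt (verit))
  moreover have "cl w \<noteq> cl u3"
    using T[of u1 u2 w] N[of u1 u2 w b] P[of w x] base x' z' by (smt (verit))
  moreover have "cl w \<noteq> cl u2"
    using T[of u1 u3 w] P[of w x] P[of w z] base x' z' by (smt (verit))
  ultimately show False using class_cases[OF r3 uV cl w(1)] by blast
qed

text \<open>Each of \<open>v1\<close>, \<open>v2\<close>, \<open>v3\<close> excludes a different
  class, so they do not all lie in the same one. Any two classes that occur supply the two vertices
  of \<open>four_colours_aux\<close>, up to a permutation of the \<open>u\<close>s and of
  \<open>a\<close>, \<open>b\<close>, \<open>c\<close>.\<close>

lemma four_colours:
  assumes r3: "r = 3" and unc: "\<not> coverable 2"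
    and none: "\<forall>e j. critical e j \<longrightarrow> other e j = {}"
    and uV: "u1 \<in> V" "u2 \<in> V" "u3 \<in> V"
    and cl: "cl u1 \<noteq> cl u2" "cl u1 \<noteq> cl u3" "cl u2 \<noteq> cl u3"
    and K: "K = {j, a, b, c}"
    and pat: "p j u1 = p j u3" "p j u2 = p j u3" "p a u2 = p a u3" "p a u1 \<noteq> p a u3"
      "p b u1 = p b u3" "p b u2 \<noteq> p b u3" "p c u1 = p c u2" "p c u3 \<noteq> p c u2"
  shows False
proof -
  note T = triple_agree[OF r3, unfolded K bex_simps, simplified]
  obtain v1 where v1: "v1 \<in> V" "p j v1 \<noteq> p j u3" "p a v1 \<noteq> p a u3"
    by (rule uncovered2[OF unc, of j a u3 u3]) (use uV K in auto)
  obtain v2 where v2: "v2 \<in> V" "p j v2 \<noteq> p j u3" "p b v2 \<noteq> p b u3"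
    by (rule uncovered2[OF unc, of j b u3 u3]) (use uV K in auto)
  obtain v3 where v3: "v3 \<in> V" "p j v3 \<noteq> p j u3" "p c v3 \<noteq> p c u2"
    by (rule uncovered2[OF unc, of j c u3 u2]) (use uV K in auto)
  have c1: "cl v1 = cl u2 \<or> cl v1 = cl u3"
    using class_cases[OF r3 uV cl v1(1)] T[of u2 u3 v1] uV cl pat v1 by (smt (verit))
  have c2: "cl v2 = cl u1 \<or> cl v2 = cl u3"
    using class_cases[OF r3 uV cl v2(1)] T[of u1 u3 v2] uV cl pat v2 by (smt (verit))
  have c3: "cl v3 = cl u1 \<or> cl v3 = cl u2"
    using class_cases[OF r3 uV cl v3(1)] T[of u1 u2 v3] uV cl pat v3 by (smt (verit))
  note A = four_colours_aux[OF r3 unc none]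
  have X13: False
    if "x \<in> V" "cl x = cl u1" "p j x \<noteq> p j u3" "p b x \<noteq> p b u3 \<or> p c x \<noteq> p c u2"
      "z \<in> V" "cl z = cl u3" "p j z \<noteq> p j u3" "p a z \<noteq> p a u3 \<or> p b z \<noteq> p b u3" for x z
    by (rule A[OF uV cl K pat that])
  have X12: False
    if "x \<in> V" "cl x = cl u1" "p j x \<noteq> p j u3" "p b x \<noteq> p b u3 \<or> p c x \<noteq> p c u2"
      "y \<in> V" "cl y = cl u2" "p j y \<noteq> p j u3" "p a y \<noteq> p a u3 \<or> p c y \<noteq> p c u2" for x y
    by (rule A[of u1 u3 u2 j a c b x y]) (use uV cl K pat that in auto)
  have X23: False
    if "y \<in> V" "cl y = cl u2" "p j y \<noteq> p j u3" "p a y \<noteq> p a u3 \<or> p c y \<noteq> p c u2"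
      "z \<in> V" "cl z = cl u3" "p j z \<noteq> p j u3" "p a z \<noteq> p a u3 \<or> p b z \<noteq> p b u3" for y z
    by (rule A[of u2 u1 u3 j b a c y z]) (use uV cl K pat that in auto)
  show False
    using c1 c2 c3 v1 v2 v3 X13 X12 X23 by metis
qed

text \<open>Name the majority component in each colour \<open>0\<close> and the odd one \<open>1\<close>, and list the colours
  by \<open>j\<close> and the sets \<^const>\<open>odd_at\<close> of \<open>a, b, c\<close>. Then the triple is \<open>(0; 1; 0; 0)\<close>,
  \<open>(0; 0; 1; 0)\<close>, \<open>(0; 0; 0; 1)\<close>, and a vertex avoiding every \<open>0\<close> except in colour \<open>q\<close> turns
  out to be the complement of \<open>a\<close>, up to the non-zero entries in the first two blocks.\<close>

lemma antipode:
  assumes r3: "r = 3" and unc: "\<not> coverable m" and m: "1 \<le> m" "card K \<le> Suc m"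
    and none: "\<forall>e j. critical e j \<longrightarrow> other e j = {}"
    and abc: "a \<in> V" "b \<in> V" "c \<in> V" "cl a \<noteq> cl b" "cl a \<noteq> cl c" "cl b \<noteq> cl c"
    and q: "q \<in> K" "p q b = p q c" "p q a \<noteq> p q b"
    and crit: "critical {a, b, c} j"
  obtains x where "x \<in> V" "cl x = cl a" "p q x = p q b"
    "\<And>i. i \<in> K \<Longrightarrow> i \<noteq> q \<Longrightarrow> p i b = p i c \<Longrightarrow> p i x \<noteq> p i b"
    "\<And>i. i \<in> K \<Longrightarrow> p i a = p i c \<Longrightarrow> p i b \<noteq> p i c \<Longrightarrow> p i x = p i b"
    "\<And>i. i \<in> K \<Longrightarrow> p i a = p i b \<Longrightarrow> p i b \<noteq> p i c \<Longrightarrow> p i x = p i c"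
proof -
  have unc1: "\<not> coverable 1" using unc m coverable_mono by blast
  \<comment> \<open>This picks a vertex of the majority component: \<open>a\<close> unless it is the
    odd one, and then \<open>b\<close>. There are enough components to avoid the majority in every
    colour but one, which is \<open>q\<close>.\<close>
  define f where "f i = (if p i a = p i b \<or> p i a = p i c then a else b)" for i
  have "card (K - {q}) \<le> m" using q(1) m finite_K by simp
  moreover have fV: "f i \<in> V" for i using abc by (simp add: f_def)
  ultimately obtain x where x: "x \<in> V" "\<And>i. i \<in> K - {q} \<Longrightarrow> p i x \<noteq> p i (f i)"
    using uncovered_map[OF unc, of "K - {q}" f] by blast
  have ne: "a \<noteq> b" "a \<noteq> c" "b \<noteq> c" using abc by auto
  have J: "i = j \<longleftrightarrow> p i a = p i b \<and> p i b = p i c" if "i \<in> K" for i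
  proof -
    have "i \<in> agr {a, b, c} \<longleftrightarrow> i = j" using crit unfolding critical_def by blast
    then show ?thesis using that unfolding agr_triple by blast
  qed
  have jK: "j \<in> K" using j_in[OF unc1 crit] .
  have eqs: "{a, b, c} = {b, a, c}" "{a, b, c} = {c, a, b}" by auto
  have not_b: "cl x \<noteq> cl b"
  proof
    assume "cl x = cl b"
    then obtain i where i: "i \<in> insert j (odd_at {a, b, c} b)" "p i x = p i a"
      using cover_class[OF unc1 crit, of b x a] x(1) ne by auto
    have "i \<in> K \<and> p i a = p i c"
      using i(1) J[of i] jK odd_at_triple[of b a c] ne eqs(1) by auto
    then have "f i = a" "i \<in> K - {q}" using q(2,3) by (auto simp: f_def)
    then show False using x(2) i(2) by metis
  qed
  have not_c: "cl x \<noteq> cl c"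
  proof
    assume "cl x = cl c"
    then obtain i where i: "i \<in> insert j (odd_at {a, b, c} c)" "p i x = p i a"
      using cover_class[OF unc1 crit, of c x a] x(1) ne by auto
    have "i \<in> K \<and> p i a = p i b"
      using i(1) J[of i] jK odd_at_triple[of c a b] ne eqs(2) by auto
    then have "f i = a" "i \<in> K - {q}" using q(2,3) by (auto simp: f_def)
    then show False using x(2) i(2) by metis
  qed
  have cx: "cl x = cl a" using class_cases[OF r3 abc x(1)] not_b not_c by auto
  have avoid: "p i x \<noteq> p i b" if "i \<in> K" "i \<noteq> q" "p i b = p i c" for i
    using x(2)[of i] that by (auto simp: f_def split: if_splits)
  have xbc: "x \<in> V" "b \<in> V" "c \<in> V" "cl x \<noteq> cl b" "cl x \<noteq> cl c" "cl b \<noteq> cl c"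
    using x(1) abc not_b not_c by auto
  obtain i where "i \<in> K" "p i x = p i b \<and> p i b = p i c"
    using triple_agree[OF r3 xbc] by auto
  then have "p q x = p q b" using avoid by metis
  have only_q: "i = q" if "i \<in> K" "p i x = p i b" "p i b = p i c" for i
    using avoid that by metis
  \<comment> \<open>The triple \<open>x\<close>, \<open>b\<close>, \<open>c\<close> has only
    \<open>q\<close> in common, so no colour separates all three vertices.\<close>
  have rainbow: "p i x = p i b \<or> p i x = p i c" if "i \<in> K" "p i b \<noteq> p i c" for i
    using no_rainbow[OF r3 unc1 none xbc that(1)] that(2) only_q by metis
  show thesis
  proof (rule that[OF x(1) cx \<open>p q x = p q b\<close>])
    show "p i x \<noteq> p i b" if "i \<in> K" "i \<noteq> q" "p i b = p i c" for i
      by (rule avoid[OF that])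
    show "p i x = p i b" if "i \<in> K" "p i a = p i c" "p i b \<noteq> p i c" for i
      using rainbow[OF that(1,3)] x(2)[of i] that q(2) by (auto simp: f_def)
    show "p i x = p i c" if "i \<in> K" "p i a = p i b" "p i b \<noteq> p i c" for i
      using rainbow[OF that(1,3)] x(2)[of i] that q(2) by (auto simp: f_def)
  qed
qed

text \<open>Let \<open>x\<close> and \<open>y\<close> be the antipodes of \<open>a\<close> and
  \<open>b\<close>. Then \<open>y\<close> and \<open>c\<close> agree only in \<open>q'\<close> and
  \<open>odd_at {a, b, c} c\<close>, \<open>x\<close> and \<open>c\<close> only in \<open>q\<close>
  and that same set, and \<open>x\<close> and \<open>b\<close> only in \<open>q\<close> and
  \<open>odd_at {a, b, c} b\<close>. A vertex in the class of \<open>a\<close>, \<open>b\<close> or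
  \<open>c\<close> shares a component with the respective pair, so these components suffice; nothing
  of the odd set of \<open>a\<close> but \<open>q\<close> is used.\<close>

lemma cover_r_3_weak_aux:
  assumes r3: "r = 3" and m: "1 \<le> m" "card K \<le> Suc m"
    and none: "\<forall>e j. critical e j \<longrightarrow> other e j = {}"
    and abc: "a \<in> V" "b \<in> V" "c \<in> V" "cl a \<noteq> cl b" "cl a \<noteq> cl c" "cl b \<noteq> cl c"
    and crit: "critical {a, b, c} j"
    and big: "card (odd_at {a, b, c} b) + card (odd_at {a, b, c} c) + 2 \<le> m"
  shows "coverable m"
proof (rule ccontr)
  assume unc: "\<not> coverable m"
  have unc1: "\<not> coverable 1" using unc m coverable_mono by blast
  have ne: "a \<noteq> b" "a \<noteq> c" "b \<noteq> c" using abc by auto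
  have perm: "{a, b, c} = {b, a, c}" "{a, b, c} = {c, a, b}" by auto
  have odd: "odd_at {a, b, c} a = {i \<in> K. p i b = p i c \<and> p i a \<noteq> p i b}"
      "odd_at {a, b, c} b = {i \<in> K. p i a = p i c \<and> p i b \<noteq> p i a}"
      "odd_at {a, b, c} c = {i \<in> K. p i a = p i b \<and> p i c \<noteq> p i a}"
    using odd_at_triple[of a b c] odd_at_triple[of b a c] odd_at_triple[of c a b] ne perm by auto
  have cases: "p i a = p i b \<or> p i a = p i c \<or> p i b = p i c" if "i \<in> K" for i
    using none crit other_triple[OF unc1 crit ne] that by auto
  obtain q where q: "q \<in> K" "p q b = p q c" "p q a \<noteq> p q b"
    using odd_at_nonempty[OF unc1 crit, of a] odd(1) by auto
  obtain q' where q': "q' \<in> K" "p q' a = p q' c" "p q' b \<noteq> p q' a"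
    using odd_at_nonempty[OF unc1 crit, of b] odd(2) by auto
  obtain x where x: "x \<in> V" "cl x = cl a" "p q x = p q b"
    "\<And>i. i \<in> K \<Longrightarrow> i \<noteq> q \<Longrightarrow> p i b = p i c \<Longrightarrow> p i x \<noteq> p i b"
    "\<And>i. i \<in> K \<Longrightarrow> p i a = p i c \<Longrightarrow> p i b \<noteq> p i c \<Longrightarrow> p i x = p i b"
    "\<And>i. i \<in> K \<Longrightarrow> p i a = p i b \<Longrightarrow> p i b \<noteq> p i c \<Longrightarrow> p i x = p i c"
    by (rule antipode[OF r3 unc m none abc q crit]) (rule that; assumption)
  have bac: "b \<in> V" "a \<in> V" "c \<in> V" "cl b \<noteq> cl a" "cl b \<noteq> cl c" "cl a \<noteq> cl c"
    using abc by auto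
  have crit': "critical {b, a, c} j" using crit perm(1) by simp
  obtain y where y: "y \<in> V" "cl y = cl b" "p q' y = p q' a"
    "\<And>i. i \<in> K \<Longrightarrow> i \<noteq> q' \<Longrightarrow> p i a = p i c \<Longrightarrow> p i y \<noteq> p i a"
    "\<And>i. i \<in> K \<Longrightarrow> p i b = p i c \<Longrightarrow> p i a \<noteq> p i c \<Longrightarrow> p i y = p i a"
    "\<And>i. i \<in> K \<Longrightarrow> p i b = p i a \<Longrightarrow> p i a \<noteq> p i c \<Longrightarrow> p i y = p i c"
    by (rule antipode[OF r3 unc m none bac q' crit']) (rule that; assumption)
  let ?B = "odd_at {a, b, c} b" and ?C = "odd_at {a, b, c} c"
  let ?T = "(\<lambda>i. (i, c)) ` ?C \<union> (\<lambda>i. (i, b)) ` ?B \<union> {(q, b), (q', a)}"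
  have "card ?T \<le> card ?C + card ?B + 2"
    by (intro order_trans[OF card_Un_le] add_mono card_image_le finite_odd_at)
      (simp add: card_insert_if)
  then have "card ?T \<le> m" using big by simp
  moreover have "?T \<subseteq> K \<times> V" using odd abc q(1) q'(1) by auto
  ultimately obtain w where w: "w \<in> V" "\<And>i u. (i, u) \<in> ?T \<Longrightarrow> p i w \<noteq> p i u"
    using uncovered[OF unc, of ?T] by metis
  have wC: "p i w \<noteq> p i c" if "i \<in> K" "p i a = p i b" "p i c \<noteq> p i a" for i
    using w(2)[of i c] that odd(3) by blast
  have wB: "p i w \<noteq> p i b" if "i \<in> K" "p i a = p i c" "p i b \<noteq> p i a" for i
    using w(2)[of i b] that odd(2) by blast
  have wq: "p q w \<noteq> p q b" "p q' w \<noteq> p q' a" using w(2) by auto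
  have hit2: "\<exists>i\<in>K. p i u = p i v \<and> p i w = p i u"
    if "u \<in> V" "v \<in> V" "cl u \<noteq> cl v" "cl w \<noteq> cl u" "cl w \<noteq> cl v" for u v
    using triple_agree[OF r3 w(1) that(1,2)] that(3-5) by auto
  have "cl w \<noteq> cl a"
  proof
    assume "cl w = cl a"
    then obtain i where "i \<in> K" "p i y = p i c" "p i w = p i y"
      using hit2[of y c] y(1,2) abc by auto
    then show False
      using cases[of i] y(3) y(4)[of i] y(5)[of i] wC[of i] wq by metis
  qed
  moreover have "cl w \<noteq> cl b"
  proof
    assume "cl w = cl b"
    then obtain i where "i \<in> K" "p i x = p i c" "p i w = p i x"
      using hit2[of x c] x(1,2) abc by auto
    then show False
      using cases[of i] x(3) x(4)[of i] x(5)[of i] wC[of i] wq by metis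
  qed
  moreover have "cl w \<noteq> cl c"
  proof
    assume "cl w = cl c"
    then obtain i where "i \<in> K" "p i x = p i b" "p i w = p i x"
      using hit2[of x b] x(1,2) abc by auto
    then show False
      using cases[of i] x(3) x(4)[of i] x(6)[of i] wB[of i] wq by metis
  qed
  ultimately show False using class_cases[OF r3 abc w(1)] by blast
qed

text \<open>Coordinates on a critical edge for \<open>r = 3\<close>, ordered so that
  \<open>a\<close> has the largest odd set, the one that \<open>cover_r_3_weak_aux\<close> does not
  have to pay for.\<close>

lemma critical_triple:
  assumes r3: "r = 3" and unc1: "\<not> coverable 1" and crit: "critical e j"
  obtains a b c where "e = {a, b, c}" "a \<in> V" "b \<in> V" "c \<in> V"
    "cl a \<noteq> cl b" "cl a \<noteq> cl c" "cl b \<noteq> cl c"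
    "card (odd_at e b) \<le> card (odd_at e a)" "card (odd_at e c) \<le> card (odd_at e a)"
    "card K = 1 + card (odd_at e a) + card (odd_at e b) + card (odd_at e c) + card (other e j)"
    "K = insert j (odd_at e a \<union> odd_at e b \<union> odd_at e c \<union> other e j)"
    "1 \<le> card (odd_at e a)" "1 \<le> card (odd_at e b)" "1 \<le> card (odd_at e c)"
    "p j a = p j c" "p j b = p j c"
    "odd_at e a = {i \<in> K. p i b = p i c \<and> p i a \<noteq> p i c}"
    "odd_at e b = {i \<in> K. p i a = p i c \<and> p i b \<noteq> p i c}"
    "odd_at e c = {i \<in> K. p i a = p i b \<and> p i c \<noteq> p i b}"
    "other e j = {i \<in> K. p i a \<noteq> p i b \<and> p i a \<noteq> p i c \<and> p i b \<noteq> p i c}"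
proof -
  have "card e = r" using crit unfolding critical_def by blast
  then have "card e = 3" using r3 by simp
  then obtain a0 b0 c0 where e0: "e = {a0, b0, c0}" "a0 \<noteq> b0" "a0 \<noteq> c0" "b0 \<noteq> c0"
    unfolding card_3_iff by auto
  let ?o = "\<lambda>m. card (odd_at e m)"
  obtain a b c where abc: "e = {a, b, c}" "a \<noteq> b" "a \<noteq> c" "b \<noteq> c"
    "?o b \<le> ?o a" "?o c \<le> ?o a"
  proof -
    have e1: "e = {b0, a0, c0}" "e = {c0, a0, b0}" using e0(1) by auto
    consider "?o b0 \<le> ?o a0" "?o c0 \<le> ?o a0" | "?o a0 \<le> ?o b0" "?o c0 \<le> ?o b0"
      | "?o a0 \<le> ?o c0" "?o b0 \<le> ?o c0" by linarith
    then show thesis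
    proof cases
      case 1
      then show thesis by (rule that[OF e0])
    next
      case 2
      then show thesis by (rule that[OF e1(1) e0(2)[symmetric] e0(4,3)])
    next
      case 3
      then show thesis by (rule that[OF e1(2) e0(3)[symmetric] e0(4)[symmetric] e0(2)])
    qed
  qed
  have "part e" using crit by (simp add: critical_def)
  then have V: "a \<in> V" "b \<in> V" "c \<in> V" and cl: "cl a \<noteq> cl b" "cl a \<noteq> cl c" "cl b \<noteq> cl c"
    using abc by (auto simp: part_iff)
  have perm: "e = {b, a, c}" "e = {c, a, b}" using abc(1) by auto
  have odd: "odd_at e a = {i \<in> K. p i b = p i c \<and> p i a \<noteq> p i c}"
      "odd_at e b = {i \<in> K. p i a = p i c \<and> p i b \<noteq> p i c}"
      "odd_at e c = {i \<in> K. p i a = p i b \<and> p i c \<noteq> p i b}"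
  proof -
    have "odd_at e a = {i \<in> K. p i b = p i c \<and> p i a \<noteq> p i b}"
      unfolding abc(1) by (rule odd_at_triple[OF abc(2,3)])
    also have "\<dots> = {i \<in> K. p i b = p i c \<and> p i a \<noteq> p i c}" by (intro Collect_cong) metis
    finally show "odd_at e a = \<dots>" .
    have "odd_at e b = {i \<in> K. p i a = p i c \<and> p i b \<noteq> p i a}"
      unfolding perm(1) by (rule odd_at_triple[OF abc(2)[symmetric] abc(4)])
    also have "\<dots> = {i \<in> K. p i a = p i c \<and> p i b \<noteq> p i c}" by (intro Collect_cong) metis
    finally show "odd_at e b = \<dots>" .
    have "odd_at e c = {i \<in> K. p i a = p i b \<and> p i c \<noteq> p i a}"
      unfolding perm(2) by (rule odd_at_triple[OF abc(3)[symmetric] abc(4)[symmetric]])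
    also have "\<dots> = {i \<in> K. p i a = p i b \<and> p i c \<noteq> p i b}" by (intro Collect_cong) metis
    finally show "odd_at e c = \<dots>" .
  qed
  have oth: "other e j = {i \<in> K. p i a \<noteq> p i b \<and> p i a \<noteq> p i c \<and> p i b \<noteq> p i c}"
    unfolding abc(1) by (rule other_triple[OF unc1 crit[unfolded abc(1)] abc(2-4)])
  have cK: "card K = 1 + ?o a + ?o b + ?o c + card (other e j)"
    using card_K[OF unc1 crit] abc(1-4) by simp
  have K: "K = insert j (odd_at e a \<union> odd_at e b \<union> odd_at e c \<union> other e j)"
  proof -
    have "m \<in> e \<longleftrightarrow> m = a \<or> m = b \<or> m = c" for m unfolding abc(1) by simp
    then have U: "(\<Union>m\<in>e. odd_at e m) = odd_at e a \<union> odd_at e b \<union> odd_at e c" by auto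
    show ?thesis
      unfolding other_def[OF unc1 crit] U
      using j_in[OF unc1 crit] odd_at_sub[of e a] odd_at_sub[of e b] odd_at_sub[of e c] by blast
  qed
  have pos: "1 \<le> ?o m" if "m \<in> e" for m
    using odd_at_nonempty[OF unc1 crit that] finite_odd_at by (simp add: Suc_le_eq card_gt_0_iff)
  have "j \<in> agr {a, b, c}" using crit unfolding critical_def abc(1) by blast
  then have pj: "p j a = p j c" "p j b = p j c" unfolding agr_triple by auto
  have "a \<in> e" "b \<in> e" "c \<in> e" using abc(1) by auto
  from that[OF abc(1) V cl abc(5,6) cK K pos[OF this(1)] pos[OF this(2)] pos[OF this(3)] pj odd oth]
  show thesis .
qed

section \<open>The bounds for one vertex per class\<close>

lemma cover_r_3_weak:
  assumes r3: "r = 3" and crit: "critical e j" and K5: "5 \<le> card K"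
  shows "coverable (card K - 1)"
proof (rule ccontr)
  assume unc: "\<not> coverable (card K - 1)"
  have unc1: "\<not> coverable 1"
  proof -
    have "1 \<le> card K - 1" using K5 by simp
    then show ?thesis using unc coverable_mono by blast
  qed
  have none: "\<forall>e j. critical e j \<longrightarrow> other e j = {}"
  proof (intro allI impI equals0I)
    fix e j f assume "critical e j" "f \<in> other e j"
    then show False using other_cover[OF unc1, of e j f "card K - 1"] unc r3 K5 by simp
  qed
  obtain a b c where t: "e = {a, b, c}" "a \<in> V" "b \<in> V" "c \<in> V"
    "cl a \<noteq> cl b" "cl a \<noteq> cl c" "cl b \<noteq> cl c"
    "card (odd_at e b) \<le> card (odd_at e a)" "card (odd_at e c) \<le> card (odd_at e a)"
    "card K = 1 + card (odd_at e a) + card (odd_at e b) + card (odd_at e c) + card (other e j)"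
    by (rule critical_triple[OF r3 unc1 crit]) (rule that; assumption)
  have "card (other e j) = 0" using none crit by simp
  \<comment> \<open>The three odd sets have total size \<open>card K - 1\<close>, at least 4, so the
    largest has at least two elements.\<close>
  then have "2 \<le> card (odd_at e a)" using t(8-10) K5 by linarith
  then have "card (odd_at e b) + card (odd_at e c) + 2 \<le> card K - 1" using t(10) by linarith
  then show False
    using cover_r_3_weak_aux[OF r3 _ _ none t(2-7), of "card K - 1" j] crit t(1) unc K5 by auto
qed

text \<open>The colour \<open>j\<close> and three nonempty odd sets use four colours already. So at
  most five colours leave three patterns: odd sets of size 1 with or without one colour in
  \<open>other\<close>, and sizes 2, 1, 1 with \<open>other\<close> empty.\<close>

lemma cover_r_3_small:
  assumes r3: "r = 3" and unc1: "\<not> coverable 1" and crit: "critical e j" and K5: "card K \<le> 5"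
  shows "coverable (card K - 2)"
proof (rule ccontr)
  assume unc: "\<not> coverable (card K - 2)"
  have small: "4 + card (other e j) \<le> card K" if "critical e j" for e j
    by (rule critical_triple[OF r3 unc1 that]) linarith
  show False
  proof (cases "\<exists>e j. critical e j \<and> other e j \<noteq> {}")
    case True
    then obtain e j where e: "critical e j" "other e j \<noteq> {}" by blast
    have "card (other e j) \<noteq> 0" using e(2) finite_other[OF unc1 e(1)] by simp
    then have o1: "card (other e j) = 1" and k5: "card K = 5" using small[OF e(1)] K5 by auto
    obtain u1 u2 u3 where t: "u1 \<in> V" "u2 \<in> V" "u3 \<in> V"
      "cl u1 \<noteq> cl u2" "cl u1 \<noteq> cl u3" "cl u2 \<noteq> cl u3"
      "card K = 1 + card (odd_at e u1) + card (odd_at e u2) + card (odd_at e u3) + card (other e j)"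
      "K = insert j (odd_at e u1 \<union> odd_at e u2 \<union> odd_at e u3 \<union> other e j)"
      "1 \<le> card (odd_at e u1)" "1 \<le> card (odd_at e u2)" "1 \<le> card (odd_at e u3)"
      "p j u1 = p j u3" "p j u2 = p j u3"
      "odd_at e u1 = {i \<in> K. p i u2 = p i u3 \<and> p i u1 \<noteq> p i u3}"
      "odd_at e u2 = {i \<in> K. p i u1 = p i u3 \<and> p i u2 \<noteq> p i u3}"
      "odd_at e u3 = {i \<in> K. p i u1 = p i u2 \<and> p i u3 \<noteq> p i u2}"
      "other e j = {i \<in> K. p i u1 \<noteq> p i u2 \<and> p i u1 \<noteq> p i u3 \<and> p i u2 \<noteq> p i u3}"
      by (rule critical_triple[OF r3 unc1 e(1)]) (rule that; assumption)
    have "card (odd_at e u1) = 1" "card (odd_at e u2) = 1" "card (odd_at e u3) = 1"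
      using t(7,9-11) o1 k5 by linarith+
    then obtain a b c f where s: "odd_at e u1 = {a}" "odd_at e u2 = {b}" "odd_at e u3 = {c}"
      "other e j = {f}" using o1 by (meson card_1_singletonE)
    have K: "K = {j, a, b, c, f}" using t(8) unfolding s by auto
    have pat: "p a u2 = p a u3" "p a u1 \<noteq> p a u3" "p b u1 = p b u3" "p b u2 \<noteq> p b u3"
      "p c u1 = p c u2" "p c u3 \<noteq> p c u2" "p f u1 \<noteq> p f u2" "p f u1 \<noteq> p f u3" "p f u2 \<noteq> p f u3"
      using t(14-17) unfolding s by blast+
    have "\<not> coverable 3" using unc k5 by simp
    from five_colours[OF r3 this t(1-6) K t(12,13) pat] show False .
  next
    case False
    then have none: "\<forall>e j. critical e j \<longrightarrow> other e j = {}" by blast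
    obtain u1 u2 u3 where t: "u1 \<in> V" "u2 \<in> V" "u3 \<in> V"
      "cl u1 \<noteq> cl u2" "cl u1 \<noteq> cl u3" "cl u2 \<noteq> cl u3"
      "card (odd_at e u2) \<le> card (odd_at e u1)" "card (odd_at e u3) \<le> card (odd_at e u1)"
      "card K = 1 + card (odd_at e u1) + card (odd_at e u2) + card (odd_at e u3) + card (other e j)"
      "K = insert j (odd_at e u1 \<union> odd_at e u2 \<union> odd_at e u3 \<union> other e j)"
      "1 \<le> card (odd_at e u1)" "1 \<le> card (odd_at e u2)" "1 \<le> card (odd_at e u3)"
      "p j u1 = p j u3" "p j u2 = p j u3"
      "odd_at e u1 = {i \<in> K. p i u2 = p i u3 \<and> p i u1 \<noteq> p i u3}"
      "odd_at e u2 = {i \<in> K. p i u1 = p i u3 \<and> p i u2 \<noteq> p i u3}"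
      "odd_at e u3 = {i \<in> K. p i u1 = p i u2 \<and> p i u3 \<noteq> p i u2}"
      by (rule critical_triple[OF r3 unc1 crit]) (rule that; assumption)
    have o0: "other e j = {}" using none crit by blast
    have c23: "card (odd_at e u2) = 1" "card (odd_at e u3) = 1"
      using t(7-9,11-13) K5 by linarith+
    then obtain b c where s: "odd_at e u2 = {b}" "odd_at e u3 = {c}" by (meson card_1_singletonE)
    have pat: "p b u1 = p b u3" "p b u2 \<noteq> p b u3" "p c u1 = p c u2" "p c u3 \<noteq> p c u2"
      using t(17,18) unfolding s by blast+
    have "card K = 4 \<or> card K = 5" using small[OF crit] K5 by auto
    then show False
    proof
      assume k4: "card K = 4"
      then have "card (odd_at e u1) = 1" using t(9) c23 o0 by simp
      then obtain a where a: "odd_at e u1 = {a}" by (meson card_1_singletonE)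
      have K: "K = {j, a, b, c}" using t(10) unfolding s a o0 by auto
      have "p a u2 = p a u3" "p a u1 \<noteq> p a u3" using t(16) unfolding a by blast+
      moreover have "\<not> coverable 2" using unc k4 by simp
      ultimately show False using four_colours[OF r3 _ none t(1-6) K t(14,15) _ _ pat] by blast
    next
      assume k5: "card K = 5"
      then have "card (odd_at e u1) = 2" using t(9) c23 o0 by simp
      then obtain a d where a: "odd_at e u1 = {a, d}" by (meson card_2_iff)
      have K: "K = {j, a, d, b, c}" using t(10) unfolding s a o0 by auto
      have "p a u2 = p a u3" "p a u1 \<noteq> p a u3" "p d u2 = p d u3" "p d u1 \<noteq> p d u3"
        using t(16) unfolding a by blast+
      moreover have "\<not> coverable 3" using unc k5 by simp
      ultimately show False using double_colour[OF r3 _ none t(1-6) K t(14,15) _ _ _ _ pat] by blast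
    qed
  qed
qed

lemma coverable_critical:
  assumes "critical e j" and c: "1 \<le> c" "card K + 1 \<le> c + r \<and> (4 \<le> r \<or> card K \<le> 5) \<or> card K + 2 \<le> c + r"
  shows "coverable c"
proof (rule ccontr)
  assume unc: "\<not> coverable c"
  have unc1: "\<not> coverable 1" using unc c(1) coverable_mono by blast
  show False
  proof (cases "4 \<le> r")
    case True
    then show False using cover_r_ge_4[OF unc1 assms(1) True, of c] c unc by auto
  next
    case False
    then have r3: "r = 3" using r_ge_3 by simp
    show False
    proof (cases "card K \<le> 5")
      case True
      have "card K - 2 \<le> c" using c(2) r3 by linarith
      then show False
        using cover_r_3_small[OF r3 unc1 assms(1) True] coverable_mono unc by blast
    next
      case False
      then have "card K - 1 \<le> c" "5 \<le> card K" using c(2) r3 by linarith+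
      then show False
        using cover_r_3_weak[OF r3 assms(1)] coverable_mono unc by blast
    qed
  qed
qed

end

text \<open>Deleting colours as long as every edge remains monochromatic in some colour
  produces a critical edge.\<close>

lemma (in partite_system) coverable_l_eq_1:
  assumes l1: "l = 1" and r3: "3 \<le> r"
    and c: "1 \<le> c" "card K + 1 \<le> c + r \<and> (4 \<le> r \<or> card K \<le> 5) \<or> card K + 2 \<le> c + r"
  shows "coverable c"
proof -
  let ?good = "\<lambda>K'. K' \<subseteq> K \<and> (\<forall>e. part e \<and> card e = r \<longrightarrow> agr e \<inter> K' \<noteq> {})"
  have "?good K" using agr_sub agr_edge by (simp add: Int_absorb2)
  then obtain K' where K': "?good K'" and min: "\<And>L. ?good L \<Longrightarrow> card K' \<le> card L"
    using ex_has_least_nat[of ?good K card] by blast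
  have finK': "finite K'" using K' finite_K finite_subset by blast
  obtain v0 where "v0 \<in> V" using card_classes r3 by fastforce
  then obtain e0 where "part e0" "card e0 = r"
    using K_nonempty span unfolding part_def by blast
  then have "K' \<noteq> {}" using K' by blast
  then obtain j where j: "j \<in> K'" by blast
  interpret K': transversal_system r l V cl K' p
  proof (unfold_locales)
    show "\<exists>i\<in>K'. \<forall>u\<in>e. \<forall>v\<in>e. p i u = p i v"
      if "e \<subseteq> V" "card e = r" "\<And>c. card {v \<in> e. cl v = c} \<le> l" for e
    proof -
      have "agr e \<inter> K' \<noteq> {}" using K' that by (simp add: part_def)
      then show ?thesis unfolding agr_def by blast
    qed
    show "\<exists>e\<subseteq>V. card e = r \<and> v \<in> e \<and> (\<forall>c. card {v \<in> e. cl v = c} \<le> l) \<and> (\<forall>w\<in>e. p i w = p i v)"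
      if "v \<in> V" "i \<in> K'" for v i
      using span[of v i] that K' by blast
  qed (use finite_V finK' \<open>K' \<noteq> {}\<close> card_classes l_pos l_le_r l1 r3 in auto)
  have "card (K' - {j}) < card K'" by (rule card_Diff1_less[OF finK' j])
  then have "\<not> ?good (K' - {j})" using min by (meson not_le)
  then obtain e where e: "part e" "card e = r" "agr e \<inter> (K' - {j}) = {}" using K' by blast
  have agr': "K'.agr e = agr e \<inter> K'" using K' unfolding agr_def K'.agr_def by blast
  then have "K'.agr e = {j}" using e K' by blast
  then have crit: "K'.critical e j"
    using e(1,2) unfolding K'.critical_def K'.part_def part_def by blast
  \<comment> \<open>Fewer colours only relax the demand on \<open>c\<close>, and a cover by
    components with colours in \<open>K'\<close> is also one for \<open>K\<close>.\<close>
  have "card K' \<le> card K" using K' finite_K by (simp add: card_mono)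
  then have "card K' + 1 \<le> c + r \<and> (4 \<le> r \<or> card K' \<le> 5) \<or> card K' + 2 \<le> c + r"
    using c(2) by linarith
  then have "K'.coverable c" by (rule K'.coverable_critical[OF crit c(1)])
  then obtain T where "T \<subseteq> K' \<times> V" "card T \<le> c \<and> (\<forall>w\<in>V. \<exists>(i, u)\<in>T. p i w = p i u)"
    unfolding K'.coverable_def by (elim exE conjE) (rule that, assumption, rule conjI)
  moreover from this(1) have "T \<subseteq> K \<times> V" using K' by blast
  ultimately show ?thesis unfolding coverable_def by (intro exI[of _ T] conjI) simp_all
qed

section \<open>Components of a colouring\<close>

definition edge_rel :: "'v set set \<Rightarrow> ('v \<times> 'v) set" where
  "edge_rel E = {(u, v). \<exists>e\<in>E. u \<in> e \<and> v \<in> e}"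

lemma edge_linked_iff: "edge_linked E u v \<longleftrightarrow> (u, v) \<in> (edge_rel E)\<^sup>+"
proof
  assume "edge_linked E u v"
  then obtain es where es: "es \<noteq> []" "set es \<subseteq> E" "u \<in> hd es" "v \<in> last es"
    "successively (\<lambda>e f. e \<inter> f \<noteq> {}) es"
    unfolding edge_linked_def by blast
  then show "(u, v) \<in> (edge_rel E)\<^sup>+"
  proof (induction es arbitrary: u rule: list_nonempty_induct)
    case (single e)
    then show ?case by (auto simp: edge_rel_def)
  next
    case (cons e es)
    then obtain x where x: "x \<in> e" "x \<in> hd es" by (cases es) auto
    then have "(x, v) \<in> (edge_rel E)\<^sup>+" using cons by (cases es) auto
    moreover have "(u, x) \<in> edge_rel E" using cons x by (auto simp: edge_rel_def)
    ultimately show ?case by (rule trancl_into_trancl2[rotated])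
  qed
next
  assume "(u, v) \<in> (edge_rel E)\<^sup>+"
  then show "edge_linked E u v"
  proof (induction rule: trancl_induct)
    case (base y)
    then obtain e where "e \<in> E" "u \<in> e" "y \<in> e" by (auto simp: edge_rel_def)
    then show ?case unfolding edge_linked_def by (intro exI[of _ "[e]"]) auto
  next
    case (step y z)
    then obtain es e where es: "es \<noteq> []" "set es \<subseteq> E" "u \<in> hd es" "y \<in> last es"
      "successively (\<lambda>e f. e \<inter> f \<noteq> {}) es" and e: "e \<in> E" "y \<in> e" "z \<in> e"
      unfolding edge_linked_def edge_rel_def by blast
    then show ?case
      unfolding edge_linked_def by (intro exI[of _ "es @ [e]"]) (auto simp: successively_append_iff)
  qed
qed

lemma sym_edge_rel_trancl: "sym ((edge_rel E)\<^sup>+)"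
  by (rule sym_trancl) (auto simp: sym_def edge_rel_def)

text \<open>The closure is not reflexive, so this is a component only for a vertex lying in some
  edge; spanning supplies such an edge in every used colour.\<close>

definition reach :: "'v set set \<Rightarrow> 'v \<Rightarrow> 'v set" where
  "reach E v = {w. (v, w) \<in> (edge_rel E)\<^sup>+}"

lemma reach_eqI: "e \<in> E \<Longrightarrow> u \<in> e \<Longrightarrow> v \<in> e \<Longrightarrow> reach E u = reach E v"
proof -
  assume "e \<in> E" "u \<in> e" "v \<in> e"
  then have "(u, v) \<in> (edge_rel E)\<^sup>+" "(v, u) \<in> (edge_rel E)\<^sup>+"
    by (auto simp: edge_rel_def)
  then show ?thesis unfolding reach_def by (blast intro: trancl_trans)
qed

lemma reach_component:
  assumes E: "\<And>e. e \<in> E \<Longrightarrow> e \<subseteq> V" and v: "e0 \<in> E" "v \<in> e0"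
  shows "v \<in> reach E v" "reach E v \<in> hypergraph_components V E"
proof -
  show vv: "v \<in> reach E v" using v by (auto simp: reach_def edge_rel_def)
  have closed: "e \<subseteq> reach E v" if "e \<in> E" "x \<in> e" "x \<in> reach E v" for e x
  proof
    fix y assume "y \<in> e"
    then have "(x, y) \<in> edge_rel E" using that by (auto simp: edge_rel_def)
    then show "y \<in> reach E v" using that(3) by (auto simp: reach_def)
  qed
  have sub: "reach E v \<subseteq> V"
  proof
    fix w assume "w \<in> reach E v"
    then have "(v, w) \<in> (edge_rel E)\<^sup>+" by (simp add: reach_def)
    then obtain x where "(x, w) \<in> edge_rel E" by (meson tranclD2)
    then show "w \<in> V" using E by (auto simp: edge_rel_def)
  qed
  let ?E = "{e \<in> E. e \<subseteq> reach E v}"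
  \<comment> \<open>A path starting in \<open>reach E v\<close> uses only edges contained in it.
    This is needed because \<open>connected_on\<close> admits no edges leaving the set.\<close>
  have "(x, y) \<in> (edge_rel ?E)\<^sup>+ \<and> y \<in> reach E v"
    if "(x, y) \<in> (edge_rel E)\<^sup>+" "x \<in> reach E v" for x y
    using that
  proof (induction rule: trancl_induct)
    case (base y)
    then obtain e where e: "e \<in> E" "x \<in> e" "y \<in> e" by (auto simp: edge_rel_def)
    then have "e \<subseteq> reach E v" using closed base(2) by blast
    then have "(x, y) \<in> edge_rel ?E" "y \<in> reach E v" using e by (auto simp: edge_rel_def)
    then show ?case by auto
  next
    case (step y z)
    then obtain e where e: "e \<in> E" "y \<in> e" "z \<in> e" by (auto simp: edge_rel_def)
    have y: "y \<in> reach E v" "(x, y) \<in> (edge_rel ?E)\<^sup>+" using step by auto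
    then have "e \<subseteq> reach E v" using closed e by blast
    then have "(y, z) \<in> edge_rel ?E" "z \<in> reach E v" using e by (auto simp: edge_rel_def)
    then show ?case using y by (auto intro: trancl_into_trancl)
  qed
  moreover have "(x, y) \<in> (edge_rel E)\<^sup>+" if "x \<in> reach E v" "y \<in> reach E v" for x y
    using that sym_edge_rel_trancl[of E] unfolding reach_def sym_def by (auto intro: trancl_trans)
  ultimately have "connected_on E (reach E v)"
    using vv unfolding connected_on_def hypergraph_connected_def edge_linked_iff by blast
  moreover have "D = reach E v" if D: "reach E v \<subseteq> D" "connected_on E D" for D
  proof
    show "D \<subseteq> reach E v"
    proof
      fix w assume w: "w \<in> D"
      show "w \<in> reach E v"
      proof (cases "w = v")
        case False
        have "v \<in> D" using vv D by auto
        have "edge_linked {e \<in> E. e \<subseteq> D} v w"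
        proof (cases "card D = 1")
          case True
          then obtain d where "D = {d}" by (rule card_1_singletonE)
          then show ?thesis using w \<open>v \<in> D\<close> \<open>w \<noteq> v\<close> by simp
        next
          case False
          then have "\<forall>x\<in>D. \<forall>y\<in>D. x \<noteq> y \<longrightarrow> edge_linked {e \<in> E. e \<subseteq> D} x y"
            using D(2) unfolding connected_on_def hypergraph_connected_def by (elim conjE disjE) simp_all
          then show ?thesis using w \<open>v \<in> D\<close> \<open>w \<noteq> v\<close> by (elim ballE[of _ _ v] ballE[of _ _ w]) simp_all
        qed
        then have "(v, w) \<in> (edge_rel {e \<in> E. e \<subseteq> D})\<^sup>+" by (simp add: edge_linked_iff)
        then have "(v, w) \<in> (edge_rel E)\<^sup>+"
          by (rule trancl_mono) (auto simp: edge_rel_def)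
        then show ?thesis by (simp add: reach_def)
      qed (use vv in simp)
    qed
  qed (use D in simp)
  ultimately show "reach E v \<in> hypergraph_components V E"
    using sub unfolding hypergraph_components_def by blast
qed

lemma partition_class:
  assumes "partition_on V P" "X \<in> P" "v \<in> X"
  shows "(THE Y. Y \<in> P \<and> v \<in> Y) = X"
proof (rule the_equality)
  fix Y assume "Y \<in> P \<and> v \<in> Y"
  then show "Y = X" using disjointD[OF partition_onD2[OF assms(1)], of X Y] assms(2,3) by blast
qed (use assms in simp)

lemma partite_system_of_coloring:
  assumes r3: "3 \<le> r" and l: "1 \<le> l" "l \<le> r"
    and cp: "complete_partite r l V E" and sp: "spanning_coloring V E c"
  obtains cl where "partite_system r l V (cl :: 'v \<Rightarrow> 'v set) (c ` E) (\<lambda>i. reach (color_edges E c i))"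
proof -
  obtain P where fin: "finite V" and P: "partition_on V P" "card P = r"
    and E: "E = {e. e \<subseteq> V \<and> card e = r \<and> (\<forall>X\<in>P. card (e \<inter> X) \<le> l)}"
    using cp unfolding complete_partite_def by blast
  define cl where "cl v = (THE X. X \<in> P \<and> v \<in> X)" for v
  have cl: "cl v = X" if "X \<in> P" "v \<in> X" for v X
    unfolding cl_def by (rule partition_class[OF P(1) that])
  have neP: "X \<noteq> {}" if "X \<in> P" for X
    using P(1) that by (auto simp: partition_on_def)
  have UP: "\<Union>P = V" using P(1) by (auto simp: partition_on_def)
  have clP: "cl v \<in> P \<and> v \<in> cl v" if "v \<in> V" for v
    using that UP cl by blast
  have classes: "cl ` V = P"
  proof
    show "P \<subseteq> cl ` V"
    proof
      fix X assume X: "X \<in> P"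
      then obtain x where "x \<in> X" using neP by auto
      then show "X \<in> cl ` V" using cl[OF X] UP X by blast
    qed
  qed (use clP in auto)
  have in_E: "e \<in> E \<longleftrightarrow> e \<subseteq> V \<and> card e = r \<and> (\<forall>X. card {v \<in> e. cl v = X} \<le> l)" for e
  proof -
    have in_P: "e \<inter> X = {v \<in> e. cl v = X}" if "X \<in> P" "e \<subseteq> V" for X
      using that cl clP by blast
    have notin_P: "card {v \<in> e. cl v = X} \<le> l" if "X \<notin> P" "e \<subseteq> V" for X
    proof -
      have empty: "{v \<in> e. cl v = X} = {}" using that clP by blast
      show ?thesis unfolding empty by simp
    qed
    have "(\<forall>X\<in>P. card (e \<inter> X) \<le> l) \<longleftrightarrow> (\<forall>X. card {v \<in> e. cl v = X} \<le> l)" if "e \<subseteq> V"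
    proof
      assume L: "\<forall>X\<in>P. card (e \<inter> X) \<le> l"
      show "\<forall>X. card {v \<in> e. cl v = X} \<le> l"
      proof
        fix X
        show "card {v \<in> e. cl v = X} \<le> l"
          using L in_P[OF _ that, of X] notin_P[OF _ that, of X] by (cases "X \<in> P") auto
      qed
    qed (simp add: in_P that)
    then show ?thesis unfolding E by blast
  qed
  \<comment> \<open>A transversal of the classes is an edge because \<open>1 \<le> l\<close>; hence
    some colour is used.\<close>
  have "E \<noteq> {}"
  proof -
    define s where "s X = (SOME x. x \<in> X)" for X :: "'v set"
    have s: "s X \<in> X" if "X \<in> P" for X using neP[OF that] unfolding s_def by (simp add: some_in_eq)
    have cls: "cl (s X) = X" if "X \<in> P" for X using cl s that by blast
    have "inj_on s P" by (rule inj_onI) (metis cls)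
    then have "card (s ` P) = r" using P(2) by (simp add: card_image)
    moreover have "s ` P \<subseteq> V" using s UP by blast
    moreover have "card {v \<in> s ` P. cl v = X} \<le> l" for X
    proof -
      have "{v \<in> s ` P. cl v = X} \<subseteq> {s X}" using cls by auto
      then have "card {v \<in> s ` P. cl v = X} \<le> card {s X}" by (intro card_mono) auto
      then show ?thesis using l by simp
    qed
    ultimately show ?thesis using in_E[of "s ` P"] by blast
  qed
  have finE: "finite E" by (rule finite_subset[of _ "Pow V"]) (use fin in_E in auto)
  have eq: "reach (color_edges E c (c e)) u = reach (color_edges E c (c e)) v"
    if "e \<in> E" "u \<in> e" "v \<in> e" for e u v
    using that by (intro reach_eqI[of e]) (auto simp: color_edges_def)
  have "partite_system r l V cl (c ` E) (\<lambda>i. reach (color_edges E c i))"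
  proof
    show "\<exists>i\<in>c ` E. \<forall>u\<in>e. \<forall>v\<in>e. reach (color_edges E c i) u = reach (color_edges E c i) v"
      if "e \<subseteq> V" "card e = r" "\<And>X. card {v \<in> e. cl v = X} \<le> l" for e
    proof -
      have "e \<in> E" using that in_E by blast
      then show ?thesis by (intro bexI[of _ "c e"] ballI eq[of e] imageI)
    qed
    show "\<exists>e\<subseteq>V. card e = r \<and> v \<in> e \<and> (\<forall>X. card {v \<in> e. cl v = X} \<le> l) \<and>
        (\<forall>w\<in>e. reach (color_edges E c i) w = reach (color_edges E c i) v)"
      if vi: "v \<in> V" "i \<in> c ` E" for v i
    proof -
      obtain e where e: "e \<in> E" "v \<in> e" "c e = i"
        using sp vi unfolding spanning_coloring_def by blast
      then have same: "\<forall>w\<in>e. reach (color_edges E c i) w = reach (color_edges E c i) v"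
        using eq[of e _ v] by blast
      have "e \<subseteq> V" "card e = r" "\<forall>X. card {v \<in> e. cl v = X} \<le> l"
        using e(1) in_E by blast+
      from this(1,2) e(2) this(3) same show ?thesis by (intro exI[of _ e] conjI)
    qed
  qed (use fin finE \<open>E \<noteq> {}\<close> classes P(2) l in auto)
  then show thesis by (rule that)
qed

lemma mono_coverable_mono: "mono_coverable k V E c m \<Longrightarrow> m \<le> n \<Longrightarrow> mono_coverable k V E c n"
  unfolding mono_coverable_def by (meson le_trans)

lemma mono_coverable_upper:
  fixes V :: "'v set"
  assumes r3: "3 \<le> r" and l: "1 \<le> l" "l \<le> r" and k: "1 + r \<le> k + l"
    and cp: "complete_partite r l V E" and ec: "edge_coloring k E c" and sp: "spanning_coloring V E c"
    and m: "m = (if l = 1 \<and> 2 * r \<le> k then 2 else 1) + (k + l - r - 1) div l"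
  shows "mono_coverable k V E c m"
proof -
  obtain cl :: "'v \<Rightarrow> 'v set" where sys: "partite_system r l V cl (c ` E) (\<lambda>i. reach (color_edges E c i))"
    by (rule partite_system_of_coloring[OF r3 l cp sp])
  interpret partite_system r l V cl "c ` E" "\<lambda>i. reach (color_edges E c i)" by (rule sys)
  have K: "c ` E \<subseteq> {1..k}" using ec by (auto simp: edge_coloring_def)
  then have cK: "card (c ` E) \<le> k" using card_mono[OF _ K] by simp
  have "coverable m"
  proof (cases "l = 1")
    case True
    \<comment> \<open>For \<open>l = 1\<close> the quotient is \<open>k - r\<close>. If
      \<open>k < 2 * r\<close>, then \<open>r = 3\<close> leaves at most five colours, as the sharp
      case of \<open>coverable_l_eq_1\<close> requires.\<close>
    have "m + r = (if 2 * r \<le> k then k + 2 else k + 1)" "1 \<le> m" using m True k by auto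
    then show ?thesis
      using cK True r3 by (intro coverable_l_eq_1) (auto split: if_splits)
  next
    case False
    let ?q = "(k + l - r - 1) div l"
    have "k + l - r - 1 < Suc ?q * l" using l by (simp add: dividend_less_div_times)
    then have "card (c ` E) \<le> r + ?q * l" using cK k by simp
    then show ?thesis using coverable_l_ge_2[of ?q] r3 l False m by simp
  qed
  then obtain T where T: "T \<subseteq> c ` E \<times> V" "card T \<le> m"
    "\<forall>w\<in>V. \<exists>(i, u)\<in>T. reach (color_edges E c i) w = reach (color_edges E c i) u"
    unfolding coverable_def by blast
  have subV: "e \<subseteq> V" if "e \<in> color_edges E c i" for e i
    using that cp unfolding color_edges_def complete_partite_def by blast
  have inc: "\<exists>e. e \<in> color_edges E c i \<and> v \<in> e" if "v \<in> V" "i \<in> c ` E" for v i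
    using sp that unfolding spanning_coloring_def color_edges_def by blast
  let ?C = "(\<lambda>(i, u). reach (color_edges E c i) u) ` T"
  have finT: "finite T" using T(1) finite_subset finite_V finite_K by blast
  have "?C \<subseteq> mono_components k V E c"
  proof
    fix C assume "C \<in> ?C"
    then obtain i u where iu: "(i, u) \<in> T" "C = reach (color_edges E c i) u" by auto
    then have "u \<in> V" "i \<in> c ` E" using T(1) by auto
    then obtain e where e: "e \<in> color_edges E c i" "u \<in> e" using inc by blast
    have "C \<in> hypergraph_components V (color_edges E c i)"
      unfolding iu(2) by (rule reach_component(2)[OF subV e])
    then show "C \<in> mono_components k V E c"
      using K \<open>i \<in> c ` E\<close> unfolding mono_components_def by blast
  qed
  moreover have "card ?C \<le> m" using card_image_le[OF finT] T(2) le_trans by blast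
  moreover have "V \<subseteq> \<Union>?C"
  proof
    fix w assume w: "w \<in> V"
    then obtain i u where iu: "(i, u) \<in> T" "reach (color_edges E c i) w = reach (color_edges E c i) u"
      using T(3) by fast
    then have "i \<in> c ` E" using T(1) by auto
    then obtain e where e: "e \<in> color_edges E c i" "w \<in> e" using inc w by blast
    have "w \<in> reach (color_edges E c i) w" by (rule reach_component(1)[OF subV e])
    then show "w \<in> \<Union>?C" using iu by force
  qed
  ultimately show ?thesis unfolding mono_coverable_def using finT by blast
qed

section \<open>The lower bound\<close>

text \<open>Vertices of the extremal example are triples (class, vector of components indexed by the
  colours, label). Component \<open>0\<close> is the large one; a vertex of class \<open>0\<close> lies outside the large
  component in at most \<open>q\<close> colours, every other vertex in at most one. The labels only provide
  enough copies of each vector to realise all colours at all vertices.\<close>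

definition vectors :: "nat \<Rightarrow> nat \<Rightarrow> nat \<Rightarrow> (nat \<Rightarrow> nat) set" where
  "vectors k q a = {f \<in> {1..k} \<rightarrow>\<^sub>E {0..q}.
     card {i \<in> {1..k}. f i \<noteq> 0} \<le> (if a = 0 then q else min 1 q)}"

lemma finite_vectors: "finite (vectors k q a)"
  unfolding vectors_def by (rule finite_subset[of _ "{1..k} \<rightarrow>\<^sub>E {0..q}"]) (auto intro: finite_PiE)

lemma vectors_card:
  "f \<in> vectors k q a \<Longrightarrow> card {i \<in> {1..k}. f i \<noteq> 0} \<le> (if a = 0 then q else min 1 q)"
  unfolding vectors_def mem_Collect_eq by (erule conjunct2)

lemma vectors_le: "f \<in> vectors k q a \<Longrightarrow> i \<in> {1..k} \<Longrightarrow> f i \<in> {0..q}"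
  unfolding vectors_def by (auto dest: PiE_mem)

text \<open>The maps \<open>A\<close>, \<open>F\<close>, \<open>L\<close> decode class, vector and
  label. With the coding left abstract the vertices can be natural numbers, over which
  \<open>cov\<close> quantifies.\<close>

locale extremal_example =
  fixes r l k q :: nat and V :: "nat set" and A L :: "nat \<Rightarrow> nat" and F :: "nat \<Rightarrow> nat \<Rightarrow> nat"
  assumes r3: "3 \<le> r" and l: "1 \<le> l" "l \<le> r" and k: "q * l + r < k + l"
    and finV: "finite V"
    and valid: "\<And>v. v \<in> V \<Longrightarrow> A v < r \<and> L v \<in> {1..k} \<and> F v \<in> vectors k q (A v)"
    and exists: "\<And>a f t. a < r \<Longrightarrow> t \<in> {1..k} \<Longrightarrow> f \<in> vectors k q a \<Longrightarrow>
                   \<exists>v\<in>V. A v = a \<and> F v = f \<and> L v = t"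
begin

definition E :: "nat set set" where
  "E = {e. e \<subseteq> V \<and> card e = r \<and> (\<forall>a<r. card {v \<in> e. A v = a} \<le> l)}"

text \<open>One exceptional label is allowed so that an arbitrary vertex, together with
  \<open>r - 1\<close> vertices labelled \<open>i\<close>, forms an edge of colour \<open>i\<close>.
  Two exceptional labels for two different colours account for at most two vertices, so
  \<open>3 \<le> r\<close> makes the colour unique.\<close>

definition main :: "nat set \<Rightarrow> nat \<Rightarrow> bool" where
  "main e i \<longleftrightarrow> i \<in> {1..k} \<and> (\<exists>x. \<forall>v\<in>e. F v i = x) \<and> card {v \<in> e. L v \<noteq> i} \<le> 1"

definition col :: "nat set \<Rightarrow> nat" where
  "col e = (if \<exists>i. main e i then SOME i. main e i else SOME i. i \<in> {1..k} \<and> (\<forall>v\<in>e. F v i = 0))"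

lemma k_pos: "1 \<le> k"
  using k l by (cases q) auto

lemma zero_vector: "(\<lambda>i\<in>{1..k}. 0) \<in> vectors k q a"
proof -
  have empty: "{i \<in> {1..k}. (\<lambda>i\<in>{1..k}. 0) i \<noteq> (0 :: nat)} = {}" by auto
  show ?thesis unfolding vectors_def mem_Collect_eq empty by simp
qed

lemma class_nonempty: "a < r \<Longrightarrow> \<exists>v\<in>V. A v = a"
  using exists[OF _ _ zero_vector, of a 1] k_pos by auto

lemma complete: "complete_partite r l V E"
proof -
  let ?X = "\<lambda>a. {v \<in> V. A v = a}"
  let ?P = "?X ` {..<r}"
  have inj: "inj_on ?X {..<r}"
  proof (rule inj_onI)
    fix a b assume "a \<in> {..<r}" "?X a = ?X b"
    moreover obtain v where "v \<in> V" "A v = a" using class_nonempty[of a] \<open>a \<in> {..<r}\<close> by auto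
    ultimately have "v \<in> ?X b" by auto
    then show "a = b" using \<open>A v = a\<close> by simp
  qed
  have "partition_on V ?P"
  proof (rule partition_onI)
    show "\<Union>?P = V" using valid by auto
    show "{} \<notin> ?P" using class_nonempty by fastforce
  qed (auto simp: disjnt_def)
  moreover have "card ?P = r" using inj by (simp add: card_image)
  moreover have "e \<inter> ?X a = {v \<in> e. A v = a}" if "e \<subseteq> V" for e a using that by auto
  then have "E = {e. e \<subseteq> V \<and> card e = r \<and> (\<forall>X\<in>?P. card (e \<inter> X) \<le> l)}"
    unfolding E_def by (intro Collect_cong conj_cong refl) auto
  ultimately show ?thesis using finV unfolding complete_partite_def by blast
qed

text \<open>Counts the colours in which some vertex of \<open>e\<close> has a non-zero entry: at
  most \<open>q\<close> for each of at most \<open>l\<close> vertices of class \<open>0\<close>, and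
  at most one for each other vertex.\<close>

lemma zero_agree:
  assumes e: "e \<in> E"
  shows "\<exists>i\<in>{1..k}. \<forall>v\<in>e. F v i = 0"
proof (rule ccontr)
  assume "\<not> ?thesis"
  then have "{1..k} \<subseteq> (\<Union>v\<in>e. {i \<in> {1..k}. F v i \<noteq> 0})" by fastforce
  moreover have fe: "finite e" using e finV finite_subset by (auto simp: E_def)
  ultimately have "k \<le> card (\<Union>v\<in>e. {i \<in> {1..k}. F v i \<noteq> 0})"
    using card_mono[of "\<Union>v\<in>e. {i \<in> {1..k}. F v i \<noteq> 0}" "{1..k}"] by simp
  also have "\<dots> \<le> (\<Sum>v\<in>e. card {i \<in> {1..k}. F v i \<noteq> 0})" by (rule card_UN_le[OF fe])
  also have "\<dots> \<le> (\<Sum>v\<in>e. if A v = 0 then q else min 1 q)"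
  proof (rule sum_mono)
    fix v assume "v \<in> e"
    then have "v \<in> V" using e by (auto simp: E_def)
    then show "card {i \<in> {1..k}. F v i \<noteq> 0} \<le> (if A v = 0 then q else min 1 q)"
      using valid by (intro vectors_card) blast
  qed
  also have "\<dots> = card {v \<in> e. A v = 0} * q + card {v \<in> e. A v \<noteq> 0} * min 1 q"
    using fe by (simp add: sum.If_cases Int_def)
  also have "card {v \<in> e. A v \<noteq> 0} = r - card {v \<in> e. A v = 0}"
  proof -
    have "{v \<in> e. A v \<noteq> 0} = e - {v \<in> e. A v = 0}" by auto
    then show ?thesis using e fe by (simp add: card_Diff_subset E_def)
  qed
  finally have le: "k \<le> card {v \<in> e. A v = 0} * q + (r - card {v \<in> e. A v = 0}) * min 1 q" .
  have n: "card {v \<in> e. A v = 0} \<le> l" using e r3 by (auto simp: E_def)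
  show False
  proof (cases q)
    case 0
    then show ?thesis using le k_pos by simp
  next
    case (Suc q')
    \<comment> \<open>With \<open>n\<close> vertices of class \<open>0\<close> the total
      \<open>n * q + (r - n)\<close> is \<open>n * (q - 1) + r\<close>, which is largest for
      \<open>n = l\<close>.\<close>
    have "k \<le> card {v \<in> e. A v = 0} * q' + r" using le Suc n l by simp
    also have "\<dots> \<le> l * q' + r" using n by simp
    finally show False using k Suc by (simp add: algebra_simps)
  qed
qed

lemma main_unique: "e \<in> E \<Longrightarrow> main e i \<Longrightarrow> main e j \<Longrightarrow> i = j"
proof (rule ccontr)
  assume e: "e \<in> E" and m: "main e i" "main e j" and "i \<noteq> j"
  have "e \<subseteq> {v \<in> e. L v \<noteq> i} \<union> {v \<in> e. L v \<noteq> j}" using \<open>i \<noteq> j\<close> by auto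
  moreover have "finite e" using e finV finite_subset by (auto simp: E_def)
  ultimately have "card e \<le> card ({v \<in> e. L v \<noteq> i} \<union> {v \<in> e. L v \<noteq> j})"
    by (intro card_mono) auto
  also have "\<dots> \<le> card {v \<in> e. L v \<noteq> i} + card {v \<in> e. L v \<noteq> j}" by (rule card_Un_le)
  also have "\<dots> \<le> 2" using m by (simp add: main_def)
  finally show False using e r3 by (simp add: E_def)
qed

lemma col_main: "e \<in> E \<Longrightarrow> main e i \<Longrightarrow> col e = i"
proof -
  assume a: "e \<in> E" "main e i"
  then have "main e (SOME i. main e i)" by (intro someI)
  then show ?thesis using main_unique[OF a(1) _ a(2)] a(2) unfolding col_def by auto
qed

lemma col: "e \<in> E \<Longrightarrow> col e \<in> {1..k} \<and> (\<exists>x. \<forall>v\<in>e. F v (col e) = x)"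
proof -
  assume e: "e \<in> E"
  show ?thesis
  proof (cases "\<exists>i. main e i")
    case True
    then obtain i where i: "main e i" by auto
    then show ?thesis unfolding col_main[OF e i] main_def by simp
  next
    case False
    have "\<exists>i. i \<in> {1..k} \<and> (\<forall>v\<in>e. F v i = 0)" using zero_agree[OF e] by blast
    from someI_ex[OF this] show ?thesis unfolding col_def if_not_P[OF False] by blast
  qed
qed

lemma coloring: "edge_coloring k E col"
  using col by (auto simp: edge_coloring_def)

lemma spanning: "spanning_coloring V E col"
  unfolding spanning_coloring_def
proof (intro ballI)
  fix v i assume v: "v \<in> V" and "i \<in> col ` E"
  then have i: "i \<in> {1..k}" using col by auto
  \<comment> \<open>The companions of \<open>v\<close> share its entry in colour \<open>i\<close>
    and are \<open>0\<close> elsewhere. At most one entry is non-zero, and none if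
    \<open>q = 0\<close>, so this vector exists in every class; hence the bound
    \<open>min 1 q\<close> in \<open>vectors\<close>.\<close>
  let ?g = "\<lambda>j\<in>{1..k}. if j = i then F v i else 0"
  have Fv: "F v \<in> vectors k q (A v)" using valid[OF v] by blast
  have g: "?g \<in> vectors k q a" for a
  proof -
    have range: "F v i \<in> {0..q}" by (rule vectors_le[OF Fv i])
    have "{j \<in> {1..k}. ?g j \<noteq> 0} \<subseteq> {i}" by auto
    then have c1: "card {j \<in> {1..k}. ?g j \<noteq> 0} \<le> 1"
      using card_mono[of "{i}"] by fastforce
    have "q = 0 \<Longrightarrow> {j \<in> {1..k}. ?g j \<noteq> 0} = {}" using range by auto
    then have "card {j \<in> {1..k}. ?g j \<noteq> 0} \<le> min 1 q" using c1 by (cases "q = 0") auto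
    moreover have "?g \<in> {1..k} \<rightarrow>\<^sub>E {0..q}" using range by (auto simp: PiE_def)
    ultimately show ?thesis unfolding vectors_def by auto
  qed
  define w where "w a = (SOME u. u \<in> V \<and> A u = a \<and> F u = ?g \<and> L u = i)" for a
  have w: "w a \<in> V \<and> A (w a) = a \<and> F (w a) = ?g \<and> L (w a) = i" if "a < r" for a
  proof -
    have "\<exists>u. u \<in> V \<and> A u = a \<and> F u = ?g \<and> L u = i" using exists[OF that i g[of a]] by blast
    then show ?thesis unfolding w_def by (rule someI_ex)
  qed
  let ?R = "{..<r} - {A v}"
  define e where "e = insert v (w ` ?R)"
  have "A v < r" using valid[OF v] by blast
  have "inj_on w ?R" by (rule inj_onI) (metis w DiffD1 lessThan_iff)
  then have "card (w ` ?R) = r - 1" using \<open>A v < r\<close> by (simp add: card_image)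
  moreover have "v \<notin> w ` ?R" using w by auto
  ultimately have "card e = r" using r3 by (simp add: e_def)
  have class1: "{u \<in> e. A u = a} \<subseteq> {if a = A v then v else w a}" for a
    using w by (auto simp: e_def)
  have "card {u \<in> e. A u = a} \<le> l" for a
    using card_mono[OF _ class1[of a]] l by simp
  then have eE: "e \<in> E" using \<open>card e = r\<close> v w by (auto simp: E_def e_def)
  have "{u \<in> e. L u \<noteq> i} \<subseteq> {v}" using w by (auto simp: e_def)
  then have "card {u \<in> e. L u \<noteq> i} \<le> 1" using card_mono[of "{v}"] by fastforce
  moreover have "F u i = F v i" if "u \<in> e" for u using that w i by (auto simp: e_def)
  ultimately have "main e i" using i unfolding main_def by blast
  then show "\<exists>e\<in>E. v \<in> e \<and> col e = i" using eE col_main by (auto simp: e_def)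
qed

text \<open>An edge of colour \<open>i\<close> is constant in entry \<open>i\<close>, so a path in
  that colour cannot change the entry. Actual components may be smaller than the named ones, which
  only makes covering harder.\<close>

lemma component_value:
  assumes "C \<in> mono_components k V E col"
  shows "\<exists>i\<in>{1..k}. \<exists>x. \<forall>v\<in>C. F v i = x"
proof -
  obtain i where i: "i \<in> {1..k}" and C: "connected_on (color_edges E col i) C"
    using assms by (auto simp: mono_components_def hypergraph_components_def)
  let ?E = "{e \<in> color_edges E col i. e \<subseteq> C}"
  have step: "F u i = F v i" if "(u, v) \<in> edge_rel ?E" for u v
    using that col by (fastforce simp: edge_rel_def color_edges_def)
  have path: "F u i = F v i" if "(u, v) \<in> (edge_rel ?E)\<^sup>+" for u v
    using that by (induction rule: trancl_induct) (auto dest: step)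
  obtain u where u: "u \<in> C" using C by (auto simp: connected_on_def)
  have "F v i = F u i" if v: "v \<in> C" for v
  proof (cases "v = u")
    case False
    have "card C \<noteq> 1"
    proof
      assume "card C = 1"
      then obtain d where "C = {d}" by (rule card_1_singletonE)
      then show False using u v False by simp
    qed
    then have "\<forall>x\<in>C. \<forall>y\<in>C. x \<noteq> y \<longrightarrow> edge_linked ?E x y"
      using C unfolding connected_on_def hypergraph_connected_def by (elim conjE disjE) simp_all
    then have "edge_linked ?E v u" using u v False by (elim ballE[of _ _ v] ballE[of _ _ u]) simp_all
    then show ?thesis using path unfolding edge_linked_iff by blast
  qed simp
  then show ?thesis using i by blast
qed

text \<open>At most \<open>q\<close> components have at most \<open>q\<close> values, so one
  \<open>y\<close> in \<open>{0..q}\<close> is missed in all colours at once. The vector equal to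
  \<open>y\<close> in the colours of the cover and \<open>0\<close> elsewhere has at most
  \<open>q\<close> non-zero entries; it therefore occurs in class \<open>0\<close> and is not
  covered.\<close>

lemma not_coverable: "\<not> mono_coverable k V E col q"
proof
  assume "mono_coverable k V E col q"
  then obtain \<C> where C: "\<C> \<subseteq> mono_components k V E col" "finite \<C>" "card \<C> \<le> q" "V \<subseteq> \<Union>\<C>"
    unfolding mono_coverable_def by blast
  have "\<forall>D\<in>\<C>. \<exists>i x. i \<in> {1..k} \<and> (\<forall>v\<in>D. F v i = x)"
    using component_value C(1) by blast
  then obtain I x where Ix: "\<And>D. D \<in> \<C> \<Longrightarrow> I D \<in> {1..k} \<and> (\<forall>v\<in>D. F v (I D) = x D)"
    by metis
  have "card (x ` \<C>) < card {0..q}" using card_image_le[OF C(2), of x] C(3) by simp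
  then have "\<not> {0..q} \<subseteq> x ` \<C>" using card_mono[OF finite_imageI[OF C(2)]] not_le by blast
  then obtain y where "y \<in> {0..q}" and y: "y \<notin> x ` \<C>" by blast
  then have yq: "y \<le> q" by simp
  let ?f = "\<lambda>i\<in>{1..k}. if i \<in> I ` \<C> then y else 0"
  have "{i \<in> {1..k}. ?f i \<noteq> 0} \<subseteq> I ` \<C>" by auto
  then have "card {i \<in> {1..k}. ?f i \<noteq> 0} \<le> card (I ` \<C>)" using C(2) by (intro card_mono) auto
  also have "\<dots> \<le> q" using card_image_le[OF C(2), of I] C(3) by simp
  finally have "?f \<in> vectors k q 0" using yq by (simp add: vectors_def)
  then obtain v where v: "v \<in> V" "F v = ?f" using exists[of 0 1 ?f] k_pos r3 by auto
  then obtain D where D: "D \<in> \<C>" "v \<in> D" using C(4) by blast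
  then have "F v (I D) = x D" "I D \<in> {1..k}" using Ix by blast+
  then show False using v(2) y D(1) by auto
qed

end

lemma lower_bound_exists:
  assumes "3 \<le> r" "1 \<le> l" "l \<le> r" "q * l + r < k + l"
  shows "\<exists>(V :: nat set) E c. complete_partite r l V E \<and> edge_coloring k E c \<and>
           spanning_coloring V E c \<and> \<not> mono_coverable k V E c q"
proof -
  let ?W = "Sigma {..<r} (\<lambda>a. vectors k q a \<times> {1..k})"
  have "finite ?W" using finite_vectors by auto
  then obtain h where h: "bij_betw h {0..<card ?W} ?W" using ex_bij_betw_nat_finite by blast
  interpret extremal_example r l k q "{0..<card ?W}" "\<lambda>v. fst (h v)" "\<lambda>v. snd (snd (h v))"
    "\<lambda>v. fst (snd (h v))"
  proof
    show "fst (h v) < r \<and> snd (snd (h v)) \<in> {1..k} \<and> fst (snd (h v)) \<in> vectors k q (fst (h v))"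
      if "v \<in> {0..<card ?W}" for v
    proof -
      obtain a f t where eq: "h v = (a, f, t)" by (metis prod_cases3)
      have "h v \<in> ?W" using bij_betwE[OF h] that by blast
      then show ?thesis unfolding eq by simp
    qed
    show "\<exists>v\<in>{0..<card ?W}. fst (h v) = a \<and> fst (snd (h v)) = f \<and> snd (snd (h v)) = t"
      if "a < r" "t \<in> {1..k}" "f \<in> vectors k q a" for a f t
    proof -
      have "(a, f, t) \<in> h ` {0..<card ?W}" using that bij_betw_imp_surj_on[OF h] by auto
      then obtain v where "(a, f, t) = h v" "v \<in> {0..<card ?W}" by (rule imageE)
      from this(1)[symmetric] this(2) show ?thesis by (intro bexI[of _ v]) simp_all
    qed
  qed (use assms in auto)
  show ?thesis using complete coloring spanning not_coverable by blast
qed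

theorem theorem3p5:
  fixes r l k :: nat
  assumes "r \<ge> 3" and "1 \<le> l" and "l \<le> r" and "k \<ge> 1 + r - l"
  shows "(\<not> (l = 1 \<and> k \<ge> 2 * r) \<longrightarrow>
            int (cov r l k) = 1 + \<lfloor>(real k - real r + real l - 1) / real l\<rfloor>) \<and>
         (l = 1 \<and> k \<ge> 2 * r \<longrightarrow>
            1 + \<lfloor>(real k - real r + real l - 1) / real l\<rfloor> \<le> int (cov r l k) \<and>
            int (cov r l k) \<le> 2 + \<lfloor>(real k - real r + real l - 1) / real l\<rfloor>)"
proof -
  let ?n = "k + l - r - 1" and ?q = "(k + l - r - 1) div l"
  let ?m = "(if l = 1 \<and> 2 * r \<le> k then 2 else 1) + ?q"
  let ?S = "\<lambda>m. \<forall>(V :: nat set) E c. complete_partite r l V E \<longrightarrow> edge_coloring k E c \<longrightarrow>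
              spanning_coloring V E c \<longrightarrow> mono_coverable k V E c m"
  have k: "1 + r \<le> k + l" using assms by linarith
  have upper: "?S ?m" using mono_coverable_upper[OF assms(1-3) k _ _ _ refl] by blast
  then have le: "cov r l k \<le> ?m" unfolding cov_def by (rule Least_le)
  have S: "?S (cov r l k)" using upper unfolding cov_def by (rule LeastI)
  have "?q * l \<le> ?n" by simp
  then have "?q * l + r < k + l" using k by linarith
  from lower_bound_exists[OF assms(1-3) this] obtain V :: "nat set" and E c where
    "complete_partite r l V E" "edge_coloring k E c" "spanning_coloring V E c"
    "\<not> mono_coverable k V E c ?q" by blast
  then have "\<not> cov r l k \<le> ?q" using S mono_coverable_mono by blast
  then have ge: "1 + ?q \<le> cov r l k" by simp
  \<comment> \<open>The hypothesis \<open>k\<close> prevents truncation in the natural subtraction,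
    so the real floor agrees with \<open>div\<close>.\<close>
  have eq: "real k - real r + real l - 1 = real ?n" using k by (simp add: of_nat_diff)
  have "\<lfloor>(real k - real r + real l - 1) / real l\<rfloor> = int ?q"
    unfolding eq by (rule floor_divide_of_nat_eq)
  then show ?thesis using le ge by (auto split: if_splits)
qed

end
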